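(* Let $X$ be a dendric shift, on a finite alphabet $A$, generated by a primitive substitution and let $\mu$ be its unique ergodic measure. For every (monoid) morphism $\varphi\colon A^*\to G$ onto a finite group $G$ and every language $L=\varphi^{-1}(K)$, $K\subseteq G$, the density $\delta_\mu(L)$ exists and is equal to $|K|/|G|$.
   Context: A shift space on a finite alphabet $A$ is a nonempty closed subset $X\subseteq A^{\mathbb Z}$ invariant under the shift map $S((x_n)_n)=(x_{n+1})_n$, such that every letter of $A$ occurs in some element of $X$. Write $x_{[i,j)}=x_i\cdots x_{j-1}$. The language $\mathcal L(X)$ is the set of all finite words $x_{[i,j)}$ with $x\in X$, $i\le j$ (including the empty word). For $w\in\mathcal L(X)$, the extension graph $E(w)$ is the undirected bipartite graph whose vertex set is the disjoint union of $\{a\in A: aw\in\mathcal L(X)\}$ and $\{b\in A: wb\in\mathcal L(X)\}$, with an edge between left vertex $a$ and right vertex $b$ when $awb\in\mathcal L(X)$. $X$ is dendric if $E(w)$ is a tree for every $w\in\mathcal L(X)$. A substitution is a monoid endomorphism $\sigma\colon A^*\to A^*$; it is primitive if there is $n\ge1$ such that for all $a,b\in A$ the letter $b$ occurs in $\sigma^n(a)$; the shift generated by $\sigma$ is the set of $x\in A^{\mathbb Z}$ all of whose finite factors occur in some $\sigma^n(a)$, $n\ge0$, $a\in A$. Shifts generated by primitive substitutions have exactly one shift-invariant Borel probability measure (Michel's theorem), which is then ergodic; this is $\mu$. The density of $L\subseteq A^*$ is $\delta_\mu(L)=\lim_{n\to\infty}\frac1n\sum_{i=0}^{n-1}\mu(\{x\in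 X:x_{[0,i)}\in L\})$. *)

theory Defs
  imports "HOL-Probability.Probability" "HOL-Algebra.Group" "HOL-Library.Sublist"
begin

definition subword :: "(int \<Rightarrow> 'a) \<Rightarrow> int \<Rightarrow> int \<Rightarrow> 'a list" where
  "subword x i j = map x [i..j - 1]"

definition shift_map :: "(int \<Rightarrow> 'a) \<Rightarrow> (int \<Rightarrow> 'a)" where
  "shift_map x = (\<lambda>n. x (n + 1))"

definition full_shift_topology :: "(int \<Rightarrow> 'a) topology" where
  "full_shift_topology = product_topology (\<lambda>_. discrete_topology UNIV) UNIV"

text \<open>The alphabet is the whole type \<open>'a\<close>.\<close>

definition shift_space :: "(int \<Rightarrow> 'a::finite) set \<Rightarrow> bool" where
  "shift_space X \<longleftrightarrow>
     X \<noteq> {} \<and> closedin full_shift_topology X \<and> shift_map ` X = X \<and>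
     (\<forall>a. \<exists>x\<in>X. \<exists>n. x n = a)"

definition language :: "(int \<Rightarrow> 'a) set \<Rightarrow> 'a list set" where
  "language X = {subword x i j | x i j. x \<in> X \<and> i \<le> j}"

definition graph_connected :: "'v set \<Rightarrow> 'v set set \<Rightarrow> bool" where
  "graph_connected V E \<longleftrightarrow>
     V \<noteq> {} \<and> (\<forall>u\<in>V. \<forall>v\<in>V. (u, v) \<in> {(p, q). {p, q} \<in> E}\<^sup>*)"

definition graph_cycle :: "'v set set \<Rightarrow> 'v list \<Rightarrow> bool" where
  "graph_cycle E vs \<longleftrightarrow>
     3 \<le> length vs \<and> distinct vs \<and>
     successively (\<lambda>p q. {p, q} \<in> E) vs \<and> {last vs, hd vs} \<in> E"

definition graph_tree :: "'v set \<Rightarrow> 'v set set \<Rightarrow> bool" where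
  "graph_tree V E \<longleftrightarrow> graph_connected V E \<and> (\<nexists>vs. graph_cycle E vs)"

definition ext_verts :: "(int \<Rightarrow> 'a) set \<Rightarrow> 'a list \<Rightarrow> ('a + 'a) set" where
  "ext_verts X w =
     Inl ` {a. a # w \<in> language X} \<union> Inr ` {b. w @ [b] \<in> language X}"

definition ext_edges :: "(int \<Rightarrow> 'a) set \<Rightarrow> 'a list \<Rightarrow> ('a + 'a) set set" where
  "ext_edges X w = {{Inl a, Inr b} | a b. a # w @ [b] \<in> language X}"

definition dendric :: "(int \<Rightarrow> 'a) set \<Rightarrow> bool" where
  "dendric X \<longleftrightarrow> (\<forall>w\<in>language X. graph_tree (ext_verts X w) (ext_edges X w))"

definition free_monoid :: "'a list monoid" where
  "free_monoid = \<lparr>carrier = UNIV, mult = (@), one = []\<rparr>"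

text \<open>Unlike \<^const>\<open>hom\<close>, a monoid morphism also has to preserve the unit.\<close>

definition monoid_hom :: "('a, 'm) monoid_scheme \<Rightarrow> ('b, 'n) monoid_scheme \<Rightarrow> ('a \<Rightarrow> 'b) set" where
  "monoid_hom M N = {h \<in> hom M N. h \<one>\<^bsub>M\<^esub> = \<one>\<^bsub>N\<^esub>}"

definition substitution :: "('a list \<Rightarrow> 'a list) \<Rightarrow> bool" where
  "substitution \<sigma> \<longleftrightarrow> \<sigma> \<in> monoid_hom free_monoid free_monoid"

definition primitive_substitution :: "('a list \<Rightarrow> 'a list) \<Rightarrow> bool" where
  "primitive_substitution \<sigma> \<longleftrightarrow>
     substitution \<sigma> \<and> (\<exists>n\<ge>1. \<forall>a b. b \<in> set ((\<sigma> ^^ n) [a]))"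

definition substitution_shift :: "('a list \<Rightarrow> 'a list) \<Rightarrow> (int \<Rightarrow> 'a) set" where
  "substitution_shift \<sigma> =
     {x. \<forall>i j. i \<le> j \<longrightarrow> (\<exists>n a. sublist (subword x i j) ((\<sigma> ^^ n) [a]))}"

definition borel_probability_on :: "(int \<Rightarrow> 'a) set \<Rightarrow> (int \<Rightarrow> 'a) measure \<Rightarrow> bool" where
  "borel_probability_on X \<mu> \<longleftrightarrow>
     prob_space \<mu> \<and> space \<mu> = X \<and>
     sets \<mu> = sigma_sets X {U. openin (subtopology full_shift_topology X) U}"

definition shift_invariant :: "(int \<Rightarrow> 'a) measure \<Rightarrow> bool" where
  "shift_invariant \<mu> \<longleftrightarrow> shift_map \<in> measurable \<mu> \<mu> \<and> distr \<mu> \<mu> shift_map = \<mu>"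

definition ergodic_measure_on :: "(int \<Rightarrow> 'a) set \<Rightarrow> (int \<Rightarrow> 'a) measure \<Rightarrow> bool" where
  "ergodic_measure_on X \<mu> \<longleftrightarrow>
     borel_probability_on X \<mu> \<and> shift_invariant \<mu> \<and>
     (\<forall>E\<in>sets \<mu>. shift_map -` E \<inter> space \<mu> = E \<longrightarrow> measure \<mu> E = 0 \<or> measure \<mu> E = 1)"

definition has_density :: "(int \<Rightarrow> 'a) measure \<Rightarrow> 'a list set \<Rightarrow> real \<Rightarrow> bool" where
  "has_density \<mu> L d \<longleftrightarrow>
     (\<lambda>n. 1 / real n * (\<Sum>i<n. measure \<mu> {x \<in> space \<mu>. subword x 0 (int i) \<in> L}))
       \<longlonglongrightarrow> d"

end

theory Submission
  imports Defs "HOL-Algebra.Generated_Groups" "HOL-Complex_Analysis.Great_Picard"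
begin

text \<open>
  Let \<open>q g w\<close> be any limit point of the averages over \<open>i < n\<close> of the measure of those \<open>x\<close> such that
  \<open>\<phi>\<close> maps \<open>x\<^bsub>[0,i)\<^esub>\<close> to \<open>g\<close> and \<open>w\<close> occurs in \<open>x\<close> at position \<open>i\<close>. These weights are the cylinder
  masses of a measure on \<open>G \<times> X\<close> that is invariant under the skew product and projects to \<open>\<mu>\<close>; it has to be
  shown that \<open>q g []\<close> does not depend on \<open>g\<close>. Let \<open>Q g w\<close> be \<open>q g w\<close> divided by the measure of the
  cylinder of \<open>w\<close>. The energy, the sum of \<open>q g w * Q g w\<close> over \<open>g\<close> and over the words \<open>w\<close> of length \<open>n\<close>,
  is nondecreasing in \<open>n\<close> and at most 1, so it hardly changes between the lengths \<open>n\<close> and \<open>D * n\<close> for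
  suitable \<open>n\<close>. As \<open>X\<close> is linearly recurrent, the cylinders of words of length between \<open>n\<close> and \<open>D * n\<close>
  have comparable measures; comparing the word \<open>u @ w = w @ s\<close> with its prefix \<open>w\<close> and with its suffix \<open>w\<close>
  then shows that \<open>Q _ w\<close> is almost invariant under right translation by \<open>\<phi> u\<close>.
  Since \<open>X\<close> is dendric, these elements \<open>\<phi> u\<close> generate \<open>G\<close>, hence \<open>Q _ w\<close> is almost uniform, and summing over
  \<open>w\<close> shows that \<open>q _ []\<close> is uniform.
\<close>

section \<open>Linear recurrence of primitive substitution shifts\<close>

lemma substitution_append: "substitution \<sigma> \<Longrightarrow> \<sigma> (u @ v) = \<sigma> u @ \<sigma> v"
  by (simp add: substitution_def monoid_hom_def hom_def free_monoid_def)

lemma substitution_Nil: "substitution \<sigma> \<Longrightarrow> \<sigma> [] = []"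
  by (simp add: substitution_def monoid_hom_def free_monoid_def)

lemma substitution_funpow:
  assumes "substitution \<sigma>"
  shows "substitution (\<sigma> ^^ n)"
proof -
  have "(\<sigma> ^^ n) (u @ v) = (\<sigma> ^^ n) u @ (\<sigma> ^^ n) v" for u v
    by (induction n arbitrary: u v) (auto simp: substitution_append[OF assms])
  moreover have "(\<sigma> ^^ n) [] = []"
    by (induction n) (auto simp: substitution_Nil[OF assms])
  ultimately show ?thesis
    by (simp add: substitution_def monoid_hom_def hom_def free_monoid_def)
qed

lemma substitution_concat:
  assumes "substitution \<sigma>"
  shows "\<sigma> z = concat (map (\<lambda>c. \<sigma> [c]) z)"
proof (induction z)
  case Nil
  then show ?case by (simp add: substitution_Nil[OF assms])
next
  case (Cons a z)
  then show ?case using substitution_append[OF assms, of "[a]" z] by simp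
qed

lemma substitution_sublist:
  assumes "substitution \<sigma>" "sublist u v"
  shows "sublist (\<sigma> u) (\<sigma> v)"
  using assms(2) unfolding sublist_def
  by (metis substitution_append[OF assms(1)])

lemma sublist_trans: "sublist u v \<Longrightarrow> sublist v w \<Longrightarrow> sublist u w"
  using sublist_order.order_trans .

text \<open>The block in which \<open>v\<close> starts covers at most \<open>M\<close> of its
  letters, so the following block begins inside \<open>v\<close> with at least \<open>M\<close>
  letters left and fits completely.\<close>

lemma sublist_concat_contains_block:
  assumes "concat (map f z) = p @ v @ s" "\<And>c. length (f c) \<le> M" "2 * M \<le> length v" "0 < M"
  shows "\<exists>c\<in>set z. sublist (f c) v"
  using assms(1)
proof (induction z arbitrary: p)
  case Nil
  then show ?case using assms by auto
next
  case (Cons c z)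
  show ?case
  proof (cases "length (f c) \<le> length p")
    case True
    then have "concat (map f z) = drop (length (f c)) p @ v @ s"
      using Cons.prems by (simp add: append_eq_append_conv_if)
    from Cons.IH[OF this] show ?thesis by auto
  next
    case False
    then obtain v1 where fc: "f c = p @ v1" and eq: "v1 @ concat (map f z) = v @ s"
      using Cons.prems by (auto simp: append_eq_append_conv2)
    have l1: "length v1 \<le> M" using assms(2)[of c] by (simp add: fc)
    have "length v1 \<le> length v" using l1 assms(3) by simp
    then obtain v2 where v: "v = v1 @ v2" and eq2: "concat (map f z) = v2 @ s"
      using eq by (auto simp: append_eq_append_conv2)
    have l2: "M \<le> length v2" using v l1 assms(3) by simp
    then obtain d z' where z: "z = d # z'" using eq2 \<open>0 < M\<close> by (cases z) auto
    have "f d = take (length (f d)) (v2 @ s)" using eq2 z by (metis append_eq_conv_conj concat.simps(2) list.simps(9))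
    also have "\<dots> = take (length (f d)) v2" using l2 assms(2)[of d] by simp
    finally have "prefix (f d) v2" by (metis take_is_prefix)
    then have "sublist (f d) v" unfolding v
      by (meson prefix_imp_sublist sublist_appendI sublist_append_leftI sublist_trans)
    then show ?thesis using z by auto
  qed
qed

text \<open>As no block is shorter than \<open>v\<close>, an occurrence of \<open>v\<close> that
  leaves the block where it starts must end in the next one.\<close>

lemma sublist_concat_two_blocks:
  assumes "concat (map f z) = p @ v @ s" "\<And>c. length v \<le> length (f c)" "v \<noteq> []"
  shows "\<exists>y. sublist y z \<and> (length y = 1 \<or> length y = 2) \<and> sublist v (concat (map f y))"
  using assms(1)
proof (induction z arbitrary: p)
  case Nil
  then show ?case using assms by auto
next
  case (Cons c z)
  show ?case
  proof (cases "length (f c) \<le> length p")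
    case True
    then have "concat (map f z) = drop (length (f c)) p @ v @ s"
      using Cons.prems by (simp add: append_eq_append_conv_if)
    from Cons.IH[OF this] show ?thesis by (meson sublist_Cons_right)
  next
    case False
    then obtain v1 where fc: "f c = p @ v1" and eq: "v1 @ concat (map f z) = v @ s"
      using Cons.prems by (auto simp: append_eq_append_conv2)
    show ?thesis
    proof (cases "length v \<le> length v1")
      case True
      then have "prefix v v1" using eq by (metis prefixI prefix_length_prefix)
      then have "sublist v (f c)" unfolding fc
        by (meson prefix_imp_sublist sublist_append_leftI sublist_trans)
      then show ?thesis by (intro exI[of _ "[c]"]) (auto simp: sublist_Cons_right)
    next
      case nle: False
      then obtain v2 where v: "v = v1 @ v2" and eq2: "concat (map f z) = v2 @ s"
        using eq by (auto simp: append_eq_append_conv2)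
      have "v2 \<noteq> []" using nle v by auto
      then obtain d z' where z: "z = d # z'" using eq2 by (cases z) auto
      have "length v2 \<le> length (f d)" using assms(2)[of d] v by simp
      then have "prefix v2 (f d)" using eq2 z by (metis concat.simps(2) list.simps(9) prefixI prefix_length_prefix)
      then have "prefix v (v1 @ f d)" by (simp add: v)
      then have "sublist v (f c @ f d)" unfolding fc
        by (metis append.assoc prefix_imp_sublist sublist_append_leftI sublist_trans)
      then show ?thesis using z by (intro exI[of _ "[c, d]"]) auto
    qed
  qed
qed

section \<open>Primitivity and uniform occurrence of factors\<close>

definition substitution_factors :: "('a list \<Rightarrow> 'a list) \<Rightarrow> 'a list set" where
  "substitution_factors \<sigma> = {w. \<exists>n a. sublist w ((\<sigma> ^^ n) [a])}"

lemma language_substitution_shift: "language (substitution_shift \<sigma>) \<subseteq> substitution_factors \<sigma>"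
  by (auto simp: language_def substitution_shift_def substitution_factors_def)

text \<open>No letter has empty image, so \<open>(\<sigma> ^^ Suc n) [a]\<close> begins with
  \<open>(\<sigma> ^^ n) [c]\<close>, where \<open>c\<close> is the first letter of
  \<open>\<sigma> [a]\<close>; the property passes from \<open>n\<close> to
  \<open>Suc n\<close>.\<close>

lemma primitive_eventually_all_letters:
  assumes "primitive_substitution \<sigma>"
  shows "\<exists>k. \<forall>n\<ge>k. \<forall>a b. b \<in> set ((\<sigma> ^^ n) [a])"
proof -
  obtain k where sub: "substitution \<sigma>" and k: "k \<ge> 1" "\<And>a b. b \<in> set ((\<sigma> ^^ k) [a])"
    using assms by (auto simp: primitive_substitution_def)
  have ne: "\<sigma> [a] \<noteq> []" for a
  proof
    assume "\<sigma> [a] = []"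
    then have "(\<sigma> ^^ Suc (k - 1)) [a] = (\<sigma> ^^ (k - 1)) []" by (simp only: funpow_Suc_right comp_def)
    also have "\<dots> = []" by (rule substitution_Nil[OF substitution_funpow[OF sub]])
    finally show False using k(1) k(2)[of a a] by simp
  qed
  have "b \<in> set ((\<sigma> ^^ n) [a])" if "n \<ge> k" for n a b
    using that
  proof (induction n arbitrary: a b rule: dec_induct)
    case base
    then show ?case by (rule k)
  next
    case (step n)
    obtain c z where cz: "\<sigma> [a] = c # z" using ne[of a] by (cases "\<sigma> [a]") auto
    have "(\<sigma> ^^ Suc n) [a] = (\<sigma> ^^ n) ([c] @ z)" by (simp only: funpow_Suc_right comp_def cz append_Cons append_Nil)
    also have "\<dots> = (\<sigma> ^^ n) [c] @ (\<sigma> ^^ n) z" by (rule substitution_append[OF substitution_funpow[OF sub]])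
    finally show ?case using step.IH[of b c] by (simp del: funpow.simps)
  qed
  then show ?thesis by blast
qed

text \<open>The letter \<open>a\<close> occurs in \<open>(\<sigma> ^^ (j - i)) [b]\<close> because
  \<open>j - i \<ge> k\<close>, and \<open>\<sigma> ^^ i\<close> preserves factors.\<close>

lemma primitive_factor_occurs:
  assumes sub: "substitution \<sigma>" and k: "\<And>n a b. n \<ge> k \<Longrightarrow> b \<in> set ((\<sigma> ^^ n) [a])"
    and "sublist w ((\<sigma> ^^ i) [a])" "j \<ge> i + k"
  shows "sublist w ((\<sigma> ^^ j) [b])"
proof -
  have "a \<in> set ((\<sigma> ^^ (j - i)) [b])" using assms(4) by (intro k) simp
  then have "sublist [a] ((\<sigma> ^^ (j - i)) [b])"
    by (metis append_Cons append_Nil split_list sublist_appendI)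
  then have "sublist ((\<sigma> ^^ i) [a]) ((\<sigma> ^^ i) ((\<sigma> ^^ (j - i)) [b]))"
    by (rule substitution_sublist[OF substitution_funpow[OF sub]])
  also have "(\<sigma> ^^ i) ((\<sigma> ^^ (j - i)) [b]) = (\<sigma> ^^ j) [b]"
    using assms(4) by (metis add_leE comp_apply funpow_add le_add_diff_inverse)
  finally show ?thesis using assms(3) sublist_trans by blast
qed

text \<open>Primitivity makes the images of the letters under one iterate comparable in length. A
  word not longer than these images lies in the image of at most two adjacent letters, every such
  pair occurs in a fixed iterate of each letter, and a long word \<open>z\<close> contains the whole
  image of some letter. By \<open>unb\<close> the images get long enough for every
  \<open>w\<close>.\<close>

theorem primitive_linearly_recurrent:
  fixes \<sigma> :: "'a::finite list \<Rightarrow> 'a list"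
  assumes prim: "primitive_substitution \<sigma>"
    and unb: "\<And>N. \<exists>w\<in>substitution_factors \<sigma>. N \<le> length w"
  shows "\<exists>C\<ge>1. \<forall>w\<in>substitution_factors \<sigma>. \<forall>z\<in>substitution_factors \<sigma>.
           w \<noteq> [] \<longrightarrow> C * length w \<le> length z \<longrightarrow> sublist w z"
proof -
  have sub: "substitution \<sigma>" using prim by (simp add: primitive_substitution_def)
  note subn = substitution_funpow[OF sub]
  obtain k where k: "\<And>n a b. n \<ge> k \<Longrightarrow> b \<in> set ((\<sigma> ^^ n) [a])"
    using primitive_eventually_all_letters[OF prim] by blast
  have occ: "sublist w ((\<sigma> ^^ j) [b])" if "sublist w ((\<sigma> ^^ i) [a])" "j \<ge> i + k" for w i j a b
    using primitive_factor_occurs[OF sub _ that] k by blast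
  define M where "M n = Max (range (\<lambda>c. length ((\<sigma> ^^ n) [c])))" for n
  have M: "length ((\<sigma> ^^ n) [c]) \<le> M n" for n c unfolding M_def by (intro Max_ge) auto
  have M_ex: "\<exists>c. M n = length ((\<sigma> ^^ n) [c])" for n
  proof -
    have "M n \<in> range (\<lambda>c. length ((\<sigma> ^^ n) [c]))" unfolding M_def by (intro Max_in) auto
    then show ?thesis by auto
  qed
  have Mlen: "length ((\<sigma> ^^ n) z) \<le> M n * length z" for n z
  proof (induction z)
    case Nil
    then show ?case by (simp add: substitution_Nil[OF subn])
  next
    case (Cons a z)
    then show ?case using substitution_append[OF subn, of n "[a]" z] M[of n a] by simp
  qed
  have Mmult: "M (i + j) \<le> M i * M j" for i j
  proof -
    obtain c where "M (i + j) = length ((\<sigma> ^^ (i + j)) [c])" using M_ex by blast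
    also have "\<dots> = length ((\<sigma> ^^ i) ((\<sigma> ^^ j) [c]))" by (simp add: funpow_add)
    also have "\<dots> \<le> M i * length ((\<sigma> ^^ j) [c])" by (rule Mlen)
    also have "\<dots> \<le> M i * M j" using M by simp
    finally show ?thesis .
  qed
  \<comment> \<open>The longest image at level \<open>n\<close> sits inside every image at level
    \<open>n + k\<close>, so the shortest images lag behind by at most \<open>k\<close>
    levels.\<close>
  have min: "M n \<le> length ((\<sigma> ^^ (n + k)) [c])" for n c
  proof -
    obtain d where d: "M n = length ((\<sigma> ^^ n) [d])" using M_ex by blast
    have "sublist ((\<sigma> ^^ n) [d]) ((\<sigma> ^^ (n + k)) [c])" by (rule occ[of _ n d]) auto
    then show ?thesis unfolding d by (rule sublist_length_le)
  qed
  have Mpos: "0 < M n" for n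
  proof (rule ccontr)
    assume "\<not> 0 < M n"
    then have "length ((\<sigma> ^^ (n + k)) [c]) = 0" for c
      using Mmult[of n k] M[of "n + k" c] by simp
    then show False using k[of "n + k"] by (metis le_add2 length_0_conv length_pos_if_in_set less_numeral_extra(3))
  qed
  have Munb: "\<exists>n. N \<le> M n" for N
  proof -
    obtain w n a where "N \<le> length w" "sublist w ((\<sigma> ^^ n) [a])"
      using unb[of N] by (auto simp: substitution_factors_def)
    then show ?thesis using M[of n a] sublist_length_le by (meson order_trans)
  qed
  \<comment> \<open>There are finitely many factors of length 1 or 2, so the maximum of their
    exponents, increased by \<open>k\<close>, serves all of them and all letters.\<close>
  obtain J where J: "\<And>y a. y \<in> substitution_factors \<sigma> \<Longrightarrow> length y = 1 \<or> length y = 2 \<Longrightarrow>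
                      sublist y ((\<sigma> ^^ J) [a])"
  proof -
    let ?Y = "{y \<in> substitution_factors \<sigma>. length y = 1 \<or> length y = 2}"
    have fin: "finite ?Y"
      by (rule finite_subset[OF _ finite_lists_length_le[of "UNIV :: 'a set" 2]]) auto
    have "\<forall>y\<in>?Y. \<exists>i a. sublist y ((\<sigma> ^^ i) [a])" by (auto simp: substitution_factors_def)
    then have "\<exists>i. \<forall>y\<in>?Y. \<exists>a. sublist y ((\<sigma> ^^ i y) [a])" by (rule bchoice)
    then obtain i where i: "\<And>y. y \<in> ?Y \<Longrightarrow> \<exists>a. sublist y ((\<sigma> ^^ i y) [a])" by blast
    define m where "m = Max (insert 0 (i ` ?Y))"
    have m: "i y \<le> m" if "y \<in> ?Y" for y unfolding m_def using fin that by (intro Max_ge) auto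
    show ?thesis
    proof (rule that)
      fix y and a :: 'a assume "y \<in> substitution_factors \<sigma>" "length y = 1 \<or> length y = 2"
      then have y: "y \<in> ?Y" by simp
      then obtain b where "sublist y ((\<sigma> ^^ i y) [b])" using i by blast
      then show "sublist y ((\<sigma> ^^ (m + k)) [a])" by (rule occ) (use m[OF y] in linarith)
    qed
  qed
  \<comment> \<open>An iterate containing \<open>w\<close> is cut into the blocks
    \<open>(\<sigma> ^^ n) [c]\<close>. Then \<open>w\<close> lies in the image of a factor
    \<open>y\<close> of length 1 or 2, and \<open>y\<close> occurs in the \<open>J\<close>-th
    iterate of every letter.\<close>
  have w_occ: "sublist w ((\<sigma> ^^ (n + J)) [a])"
    if w: "w \<in> substitution_factors \<sigma>" "w \<noteq> []" and n: "\<And>c. length w \<le> length ((\<sigma> ^^ n) [c])" for w n a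
  proof -
    obtain i b where "sublist w ((\<sigma> ^^ i) [b])" using w by (auto simp: substitution_factors_def)
    then have "sublist w ((\<sigma> ^^ (n + (i + k))) [b])" by (rule occ) simp
    then have "sublist w ((\<sigma> ^^ n) ((\<sigma> ^^ (i + k)) [b]))" by (simp add: funpow_add)
    then obtain p s where "concat (map (\<lambda>c. (\<sigma> ^^ n) [c]) ((\<sigma> ^^ (i + k)) [b])) = p @ w @ s"
      unfolding sublist_def substitution_concat[OF subn, symmetric] by blast
    from sublist_concat_two_blocks[OF this n w(2)] obtain y where
      y: "sublist y ((\<sigma> ^^ (i + k)) [b])" "length y = 1 \<or> length y = 2" "sublist w ((\<sigma> ^^ n) y)"
      unfolding substitution_concat[OF subn, symmetric] by blast
    then have "sublist y ((\<sigma> ^^ J) [a])" by (intro J) (auto simp: substitution_factors_def)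
    then have "sublist ((\<sigma> ^^ n) y) ((\<sigma> ^^ n) ((\<sigma> ^^ J) [a]))"
      by (rule substitution_sublist[OF subn])
    then show ?thesis using y(3) sublist_trans by (auto simp: funpow_add)
  qed
  have z_contains: "\<exists>c. sublist ((\<sigma> ^^ n) [c]) z"
    if z: "z \<in> substitution_factors \<sigma>" "2 * M n \<le> length z" for z n
  proof -
    obtain i b where "sublist z ((\<sigma> ^^ i) [b])" using z by (auto simp: substitution_factors_def)
    then have "sublist z ((\<sigma> ^^ (n + (i + k))) [b])" by (rule occ) simp
    then have "sublist z ((\<sigma> ^^ n) ((\<sigma> ^^ (i + k)) [b]))" by (simp add: funpow_add)
    then obtain p s where "concat (map (\<lambda>c. (\<sigma> ^^ n) [c]) ((\<sigma> ^^ (i + k)) [b])) = p @ z @ s"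
      unfolding sublist_def substitution_concat[OF subn, symmetric] by blast
    from sublist_concat_contains_block[OF this M z(2) Mpos] show ?thesis by blast
  qed
  \<comment> \<open>The two summands serve the cases \<open>n > 0\<close> and \<open>n = 0\<close>
    of \<open>bound\<close> below; the factor 2 is the length required by
    \<open>z_contains\<close>.\<close>
  define C where "C = 2 * (M (k + J + 1) + M (k + J))"
  have "sublist w z" if w: "w \<in> substitution_factors \<sigma>" "w \<noteq> []" and z: "z \<in> substitution_factors \<sigma>"
    and l: "C * length w \<le> length z" for w z
  proof -
    \<comment> \<open>For \<open>n > 0\<close> minimality gives \<open>M (n - 1) < length w\<close>,
      and submultiplicativity of \<open>M\<close> turns this into a linear bound for
      \<open>M (n + k + J)\<close>.\<close>
    define n where "n = (LEAST n. length w \<le> M n)"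
    have n: "length w \<le> M n" unfolding n_def using Munb by (rule LeastI_ex)
    have bound: "M (n + k + J) \<le> (M (k + J + 1) + M (k + J)) * length w"
    proof (cases n)
      case 0
      have "M (k + J) \<le> M (k + J) * length w" using w(2) by (cases w) auto
      then show ?thesis unfolding 0 add_0 add_mult_distrib by (rule trans_le_add2)
    next
      case (Suc n')
      have "\<not> length w \<le> M n'" using not_less_Least[of n' "\<lambda>n. length w \<le> M n"] Suc unfolding n_def by simp
      moreover have "M (n + k + J) \<le> M (k + J + 1) * M n'"
        using Mmult[of "k + J + 1" n'] by (simp add: Suc add.commute add.left_commute)
      ultimately have "M (n + k + J) \<le> M (k + J + 1) * length w"
        by (meson le_trans linear mult_le_mono2)
      then show ?thesis by (simp add: add_mult_distrib)
    qed
    have "2 * M (n + k + J) \<le> length z" using bound l by (simp add: C_def algebra_simps)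
    from z_contains[OF z this] obtain c where c: "sublist ((\<sigma> ^^ (n + k + J)) [c]) z" ..
    have "sublist w ((\<sigma> ^^ (n + k + J)) [c])"
      using w by (rule w_occ) (use min n le_trans in blast)
    then show ?thesis using c by (rule sublist_trans)
  qed
  moreover have "C \<ge> 1" using Mpos[of "k + J"] by (simp add: C_def)
  ultimately show ?thesis by blast
qed

section \<open>Return words in dendric shifts\<close>

lemma length_subword [simp]: "length (subword x i j) = nat (j - i)"
  by (simp add: subword_def)

lemma subword_eq_map: "subword x i j = map (\<lambda>k. x (i + int k)) [0..<nat (j - i)]"
  by (rule nth_equalityI) (auto simp: subword_def)

lemma subword_append:
  assumes "i \<le> j" "j \<le> k"
  shows "subword x i k = subword x i j @ subword x j k"
  unfolding subword_def using assms upto_split1[of i "j" "k - 1"] 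
  by (cases "j = k") (auto simp flip: map_append)

lemma subword_single: "subword x i (i + 1) = [x i]"
  by (simp add: subword_def)

lemma subword_mem_language: "x \<in> X \<Longrightarrow> i \<le> j \<Longrightarrow> subword x i j \<in> language X"
  by (auto simp: language_def)

lemma language_sublist:
  assumes "v \<in> language X" "sublist w v"
  shows "w \<in> language X"
proof -
  obtain x i j where x: "x \<in> X" "i \<le> j" "v = subword x i j" using assms(1) by (auto simp: language_def)
  obtain p s where v: "v = p @ w @ s" using assms(2) by (auto simp: sublist_def)
  define i' where "i' = i + int (length p)"
  define j' where "j' = i' + int (length w)"
  have l: "nat (j - i) = length p + length w + length s" using arg_cong[OF v, of length] x(3) by simp
  then have ij: "i \<le> i'" "i' \<le> j'" "j' \<le> j" using x(2) by (auto simp: i'_def j'_def)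
  have "p @ w @ s = subword x i i' @ subword x i' j' @ subword x j' j"
    using v x(3) subword_append[of i i' j x] subword_append[of i' j' j x] ij by simp
  moreover have "length p = length (subword x i i')" "length w = length (subword x i' j')"
    by (auto simp: i'_def j'_def)
  ultimately have "w = subword x i' j'" by simp
  then show ?thesis using x(1) ij subword_mem_language by blast
qed

lemma language_extend:
  assumes "w \<in> language X" "length w \<le> n"
  shows "\<exists>s. w @ s \<in> language X \<and> length (w @ s) = n"
proof -
  obtain x i j where x: "x \<in> X" "i \<le> j" "w = subword x i j" using assms(1) by (auto simp: language_def)
  have "subword x i (i + int n) = w @ subword x j (i + int n)"
    unfolding x(3) using x(2,3) assms(2) by (intro subword_append) auto
  moreover have "subword x i (i + int n) \<in> language X" using x(1) by (intro subword_mem_language) auto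
  ultimately show ?thesis by (metis add_diff_cancel_left' length_subword nat_int)
qed

section \<open>Extension graphs and returns\<close>

lemma dendric_connected:
  assumes "dendric X" "y \<in> language X" "u \<in> ext_verts X y" "v \<in> ext_verts X y"
  shows "(u, v) \<in> {(p, q). {p, q} \<in> ext_edges X y}\<^sup>*"
  using assms unfolding dendric_def graph_tree_def graph_connected_def by blast

lemma ext_edges_cases:
  assumes "{p, q} \<in> ext_edges X y"
  obtains a b where "p = Inl a" "q = Inr b" "a # y @ [b] \<in> language X"
  | a b where "p = Inr b" "q = Inl a" "a # y @ [b] \<in> language X"
  using assms by (auto simp: ext_edges_def doubleton_eq_iff)

text \<open>The induction on \<open>n\<close> works because connectedness of the extension graphs makes such a \<open>c\<close> factor
  through the words of length \<open>n - 1\<close>.\<close>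

lemma dendric_equivariant_constant:
  assumes den: "dendric X"
    and inj: "\<And>a. inj_on (act a) S"
    and letters: "\<And>a. [a] \<in> language X"
    and S: "\<And>z. z \<in> language X \<Longrightarrow> length z = n \<Longrightarrow> c z \<in> S"
    and equi: "\<And>v. v \<in> language X \<Longrightarrow> length v = Suc n \<Longrightarrow> c (butlast v) = act (hd v) (c (tl v))"
  shows "\<exists>s\<in>S. (\<forall>a. act a s = s) \<and> (\<forall>z\<in>language X. length z = n \<longrightarrow> c z = s)"
  using S equi
proof (induction n arbitrary: c)
  case 0
  have "[] \<in> language X" using letters language_sublist by blast
  then show ?case using 0(1)[of "[]"] 0(2)[OF letters] by (intro bexI[of _ "c []"]) auto
next
  case (Suc n)
  have "\<exists>s\<in>S. (\<forall>b. y @ [b] \<in> language X \<longrightarrow> c (y @ [b]) = s) \<and>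
              (\<forall>a. a # y \<in> language X \<longrightarrow> c (a # y) = act a s)"
    if y: "y \<in> language X" "length y = n" for y
  proof -
    obtain s' where s': "y @ s' \<in> language X" "length (y @ s') = Suc n"
      using language_extend[OF y(1), of "Suc n"] y(2) by auto
    then obtain b0 where b0: "y @ [b0] \<in> language X" using y(2) by (cases s') auto
    define s where "s = c (y @ [b0])"
    have sS: "s \<in> S" unfolding s_def using b0 y by (intro Suc.prems(1)) auto
    \<comment> \<open>\<open>P\<close> spreads the value \<open>s\<close> along the edges at
      \<open>y\<close>, where an edge between \<open>a\<close> and \<open>b\<close> means
      \<open>c (a # y) = act a (c (y @ [b]))\<close>. Passing from a left to a right vertex uses
      injectivity of \<open>act a\<close>; connectedness reaches all vertices.\<close>
    define P where "P v = (case v of Inl a \<Rightarrow> a # y \<in> language X \<longrightarrow> c (a # y) = act a s | Inr b \<Rightarrow> c (y @ [b]) = s)" for v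
    have e: "c (a # y) = act a (c (y @ [b]))" if "a # y @ [b] \<in> language X" for a b
      using Suc.prems(2)[OF that] y by (simp add: butlast_append)
    have P: "P v" if "v \<in> ext_verts X y" for v
    proof -
      have "Inr b0 \<in> ext_verts X y" using b0 by (auto simp: ext_verts_def)
      from dendric_connected[OF den y(1) this that] show "P v"
      proof (induction rule: rtrancl_induct)
        case base
        then show ?case by (simp add: P_def s_def)
      next
        case (step p q)
        then have "{p, q} \<in> ext_edges X y" by simp
        then show ?case
        proof (cases rule: ext_edges_cases)
          case (1 a b)
          have "a # y \<in> language X" "y @ [b] \<in> language X"
            by (rule language_sublist[OF 1(3)], simp add: sublist_def, metis append_Cons append_Nil append.right_neutral)+
          then show ?thesis using step.IH e[OF 1(3)] 1 inj[of a] sS Suc.prems(1)[of "y @ [b]"] y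
            by (auto simp: P_def inj_on_eq_iff)
        next
          case (2 a b)
          then show ?thesis using step.IH e[OF 2(3)] by (simp add: P_def)
        qed
      qed
    qed
    have "c (y @ [b]) = s" if "y @ [b] \<in> language X" for b
      using P[of "Inr b"] that by (auto simp: P_def ext_verts_def)
    moreover have "c (a # y) = act a s" if "a # y \<in> language X" for a
      using P[of "Inl a"] that by (auto simp: P_def ext_verts_def)
    ultimately show ?thesis using sS by blast
  qed
  then obtain c' where c'S: "\<And>y. y \<in> language X \<Longrightarrow> length y = n \<Longrightarrow> c' y \<in> S"
    and c'r: "\<And>y b. y \<in> language X \<Longrightarrow> length y = n \<Longrightarrow> y @ [b] \<in> language X \<Longrightarrow> c (y @ [b]) = c' y"
    and c'l: "\<And>y a. y \<in> language X \<Longrightarrow> length y = n \<Longrightarrow> a # y \<in> language X \<Longrightarrow> c (a # y) = act a (c' y)"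
    by metis
  have cv: "c v = c' (butlast v)" if v: "v \<in> language X" "length v = Suc n" for v
  proof -
    have "v = butlast v @ [last v]" using v by (metis append_butlast_last_id list.size(3) nat.distinct(1))
    moreover have "butlast v \<in> language X"
      by (rule language_sublist[OF v(1)]) (metis calculation sublist_append_rightI)
    ultimately show ?thesis using c'r[of "butlast v" "last v"] v by simp
  qed
  \<comment> \<open>Both sides equal \<open>c v\<close>: one splits off the last letter of
    \<open>v\<close>, the other the first. So \<open>c'\<close> satisfies the hypothesis one length
    lower.\<close>
  have "c' (butlast v) = act (hd v) (c' (tl v))" if v: "v \<in> language X" "length v = Suc n" for v
  proof -
    have "v = hd v # tl v" using v by (cases v) auto
    moreover have "tl v \<in> language X" by (rule language_sublist[OF v(1)]) simp
    ultimately show ?thesis using c'l[of "tl v" "hd v"] cv[OF v] v by simp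
  qed
  from Suc.IH[OF c'S this] obtain s where s: "s \<in> S" "\<And>a. act a s = s"
    "\<And>z. z \<in> language X \<Longrightarrow> length z = n \<Longrightarrow> c' z = s" by blast
  have "c z = s" if "z \<in> language X" "length z = Suc n" for z
  proof -
    have "butlast z \<in> language X" by (rule language_sublist[OF that(1)]) (auto simp: sublist_butlast)
    then show ?thesis using cv[OF that] s(3) that by simp
  qed
  then show ?case using s by blast
qed

definition close_returns :: "'a list set \<Rightarrow> 'a list \<Rightarrow> nat \<Rightarrow> 'a list set" where
  "close_returns L w n = {u. u @ w \<in> L \<and> prefix w (u @ w) \<and> length (u @ w) \<le> n}"

lemma monoid_hom_free_append:
  assumes "\<phi> \<in> monoid_hom free_monoid G"
  shows "\<phi> (u @ v) = \<phi> u \<otimes>\<^bsub>G\<^esub> \<phi> v"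
  using assms by (auto simp: monoid_hom_def hom_def free_monoid_def)

lemma monoid_hom_free_closed:
  assumes "\<phi> \<in> monoid_hom free_monoid G"
  shows "\<phi> u \<in> carrier G"
  using assms by (auto simp: monoid_hom_def hom_def free_monoid_def)

lemma monoid_hom_free_Nil:
  assumes "\<phi> \<in> monoid_hom free_monoid G"
  shows "\<phi> [] = \<one>\<^bsub>G\<^esub>"
  using assms by (auto simp: monoid_hom_def hom_def free_monoid_def)

text \<open>Let \<open>H\<close> be the generated subgroup. A word \<open>z\<close> of length
  \<open>n\<close> is labelled by the left coset of \<open>H\<close> given by the letters before the
  first \<open>w\<close> in \<open>z\<close>. Moving the window by one letter acts on the label
  through that letter, because a discrepancy would be a return to \<open>w\<close>, with image in
  \<open>H\<close>. By \<open>dendric_equivariant_constant\<close> all labels agree and are fixed by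
  every letter; one of them is \<open>H\<close>.\<close>

theorem dendric_returns_generate:
  fixes G :: "('g, 'm) monoid_scheme" (structure)
  assumes den: "dendric X" and letters: "\<And>a. [a] \<in> language X"
    and G: "group G" and hom: "\<phi> \<in> monoid_hom free_monoid G" and onto: "\<phi> ` UNIV = carrier G"
    and w: "w \<in> language X" "length w \<le> n" "w \<noteq> []"
    and rec: "\<And>z. z \<in> language X \<Longrightarrow> length z = n \<Longrightarrow> sublist w z"
  shows "generate G (\<phi> ` close_returns (language X) w (Suc n)) = carrier G"
proof -
  interpret group G by (rule G)
  note happ = monoid_hom_free_append[OF hom]
  note hcl = monoid_hom_free_closed[OF hom]
  note hnil = monoid_hom_free_Nil[OF hom]
  define R where "R = \<phi> ` close_returns (language X) w (Suc n)"
  define H where "H = generate G R"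
  have Rsub: "R \<subseteq> carrier G" using hcl by (auto simp: R_def)
  have subH: "subgroup H G" unfolding H_def by (rule generate_is_subgroup[OF Rsub])
  have Hsub: "H \<subseteq> carrier G" using subH by (rule subgroup.subset)
  define p where "p z = (LEAST i. prefix w (drop i z))" for z
  define c where "c z = \<phi> (take (p z) z) <# H" for z
  define act where "act a Z = \<phi> [a] <# Z" for a :: 'a and Z :: "'g set"
  have p: "prefix w (drop (p z) z)" if "z \<in> language X" "length z = n" for z
  proof -
    have "\<exists>i. prefix w (drop i z)" using rec[OF that] unfolding sublist_def
      by (metis append_eq_conv_conj prefixI)
    then show ?thesis unfolding p_def by (rule LeastI_ex)
  qed
  have p_le: "p z \<le> i" if "prefix w (drop i z)" for z i unfolding p_def using that by (rule Least_le)
  have "\<exists>s\<in>Pow (carrier G). (\<forall>a. act a s = s) \<and> (\<forall>z\<in>language X. length z = n \<longrightarrow> c z = s)"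
  proof (rule dendric_equivariant_constant[OF den _ letters])
    fix a :: 'a
    show "inj_on (act a) (Pow (carrier G))"
    proof (rule inj_onI)
      fix Z Z' assume *: "Z \<in> Pow (carrier G)" "Z' \<in> Pow (carrier G)" "act a Z = act a Z'"
      then have "inv (\<phi> [a]) <# (\<phi> [a] <# Z) = inv (\<phi> [a]) <# (\<phi> [a] <# Z')" by (simp add: act_def)
      then show "Z = Z'" using * hcl by (simp add: lcos_m_assoc lcos_mult_one)
    qed
  next
    fix z assume "z \<in> language X" "length z = n"
    show "c z \<in> Pow (carrier G)" unfolding c_def using l_coset_subset_G[OF Hsub hcl] by blast
  next
    fix v assume v: "v \<in> language X" "length v = Suc n"
    define z where "z = butlast v"
    define z' where "z' = tl v"
    obtain a where a: "v = a # z'" using v by (cases v) (auto simp: z'_def)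
    obtain b where b: "v = z @ [b]" using v by (metis append_butlast_last_id list.size(3) nat.distinct(1) z_def)
    have z: "z \<in> language X" "length z = n" and z': "z' \<in> language X" "length z' = n"
      using v language_sublist[OF v(1)] by (auto simp: z_def z'_def sublist_butlast)
    have fac: "act a (c z') = \<phi> (a # take (p z') z') <# H"
      unfolding act_def c_def using happ[of "[a]" "take (p z') z'"] hcl Hsub by (simp add: lcos_m_assoc)
    have "c z = act a (c z')"
    proof (cases "p z = 0")
      case True
      \<comment> \<open>Here \<open>v\<close> starts with \<open>w\<close>, and \<open>w\<close>
        occurs again after \<open>u\<close>. Hence \<open>u\<close> is a return, and
        \<open>u @ w\<close> is a prefix of \<open>v\<close>, which explains the bound
        \<open>Suc n\<close>.\<close>
      define u where "u = a # take (p z') z'"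
      obtain t where t: "drop (p z') z' = w @ t" using p[OF z'] by (auto simp: prefix_def)
      have vu: "v = u @ w @ t" using a t by (simp add: u_def) (metis append_take_drop_id)
      have "prefix w z" using p[OF z] True by simp
      then have "prefix w v" using b by (simp add: prefix_def) (metis append.assoc)
      then have "prefix w (u @ w)" using vu by (metis append.assoc le_add2 length_append prefix_length_prefix prefixI)
      moreover have "u @ w \<in> language X" by (rule language_sublist[OF v(1)]) (simp add: vu flip: append_assoc)
      moreover have "length (u @ w) \<le> Suc n" using v(2) vu by simp
      ultimately have "\<phi> u \<in> R" by (auto simp: R_def close_returns_def)
      then have uH: "\<phi> u \<in> H" unfolding H_def by (rule generate.incl)
      have "c z = H" using True by (simp add: c_def hnil lcos_mult_one[OF Hsub])
      moreover have "\<phi> u <# H = H" using uH subH by (metis coset_join3 hcl)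
      ultimately show ?thesis unfolding fac u_def by simp
    next
      case False
      have shift: "drop i z' = drop (Suc i) z @ [b]" "take (Suc i) z = a # take i z'" if "Suc i \<le> n" for i
      proof -
        have "drop i z' = drop (Suc i) v" "a # take i z' = take (Suc i) v" by (simp_all add: a)
        then show "drop i z' = drop (Suc i) z @ [b]" "take (Suc i) z = a # take i z'"
          using that z(2) by (simp_all add: b)
      qed
      have pz: "p z + length w \<le> n"
        using prefix_length_le[OF p[OF z]] w(3) z(2) by (cases "w") auto
      obtain i where i: "p z = Suc i" using False by (cases "p z") auto
      \<comment> \<open>The occurrence at \<open>Suc i\<close> in \<open>z\<close> is one at
        \<open>i\<close> in \<open>z'\<close>. Conversely, as \<open>p z' \<le> i\<close>, the first
        occurrence in \<open>z'\<close> ends before the new letter \<open>b\<close> and is thus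
        visible in \<open>z\<close>. So \<open>p z = Suc (p z')\<close>.\<close>
      have "prefix w (drop (Suc i) z @ [b])" using p[OF z] by (simp add: i)
      then have le: "p z' \<le> i" using shift(1)[of i] pz i by (intro p_le) simp
      have "prefix w (drop (Suc (p z')) z @ [b])" using p[OF z'] shift(1)[of "p z'"] le pz i by simp
      then have "prefix w (drop (Suc (p z')) z)"
        by (rule prefix_length_prefix) (use le pz i z(2) in auto)
      then have "p z \<le> Suc (p z')" by (rule p_le)
      then have "p z = Suc (p z')" using le i by simp
      moreover have "take (Suc (p z')) z = a # take (p z') z'" using shift(2)[of "p z'"] le pz i by simp
      ultimately show ?thesis unfolding fac by (simp add: c_def)
    qed
    moreover have "hd v = a" by (simp add: a)
    ultimately show "c (butlast v) = act (hd v) (c (tl v))" by (simp only: z_def z'_def)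
  qed
  then obtain s where s: "\<And>a. act a s = s" "\<And>z. z \<in> language X \<Longrightarrow> length z = n \<Longrightarrow> c z = s" "s \<subseteq> carrier G"
    by blast
  \<comment> \<open>A word starting with \<open>w\<close> has nothing before its first
    \<open>w\<close>, which identifies the common coset as \<open>H\<close>.\<close>
  obtain t where t: "w @ t \<in> language X" "length (w @ t) = n" using language_extend[OF w(1,2)] by blast
  have "p (w @ t) = 0" using p_le[of 0 "w @ t"] by simp
  then have "c (w @ t) = H" by (simp add: c_def hnil lcos_mult_one[OF Hsub])
  then have sH: "s = H" using s(2)[OF t] by simp
  have "\<phi> v <# H = H" for v
  proof (induction v)
    case Nil
    then show ?case by (simp add: hnil lcos_mult_one[OF Hsub])
  next
    case (Cons a v)
    have "\<phi> (a # v) <# H = \<phi> [a] <# (\<phi> v <# H)"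
      using happ[of "[a]" v] hcl Hsub by (simp add: lcos_m_assoc)
    then show ?case using Cons s(1)[of a] by (simp add: act_def sH)
  qed
  moreover have "\<phi> v \<in> \<phi> v <# H" for v
    unfolding l_coset_def using subgroup.one_closed[OF subH] hcl[of v] r_one[OF hcl[of v]] by force
  ultimately have "\<phi> v \<in> H" for v by blast
  then have "carrier G \<subseteq> H" unfolding onto[symmetric] by blast
  then show ?thesis using Hsub by (auto simp: H_def R_def)
qed

section \<open>Equidistribution of invariant weights on a group extension\<close>

lemma square_diff_le: "(b - c)\<^sup>2 \<le> 2 * ((a - b)\<^sup>2 + (a - c)\<^sup>2)" for a b c :: real
proof -
  have "2 * ((a - b)\<^sup>2 + (a - c)\<^sup>2) = (b - c)\<^sup>2 + (2 * a - b - c)\<^sup>2"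
    by (simp add: power2_eq_square algebra_simps)
  then show ?thesis by simp
qed

text \<open>The variance identity: with weights \<open>y t\<close>, the ratios
  \<open>x t / y t\<close> have mean \<open>X / Y\<close>. The assumptions \<open>zero\<close> and
  \<open>XY\<close> handle vanishing denominators, where division yields 0.\<close>

lemma sum_weighted_deviation:
  fixes x y :: "'t \<Rightarrow> real"
  assumes zero: "\<And>t. t \<in> T \<Longrightarrow> y t = 0 \<Longrightarrow> x t = 0"
    and X: "X = (\<Sum>t\<in>T. x t)" and Y: "Y = (\<Sum>t\<in>T. y t)" and XY: "Y = 0 \<Longrightarrow> X = 0"
  shows "(\<Sum>t\<in>T. y t * (x t / y t - X / Y)\<^sup>2) = (\<Sum>t\<in>T. (x t)\<^sup>2 / y t) - X\<^sup>2 / Y"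
proof -
  define c where "c = X / Y"
  have "y t * (x t / y t - c)\<^sup>2 = (x t)\<^sup>2 / y t - 2 * c * x t + c\<^sup>2 * y t" if "t \<in> T" for t
    using zero[OF that] by (cases "y t = 0") (auto simp: field_simps power2_eq_square)
  then have "(\<Sum>t\<in>T. y t * (x t / y t - c)\<^sup>2) = (\<Sum>t\<in>T. (x t)\<^sup>2 / y t - 2 * c * x t + c\<^sup>2 * y t)"
    by simp
  also have "\<dots> = (\<Sum>t\<in>T. (x t)\<^sup>2 / y t) - 2 * c * X + c\<^sup>2 * Y"
    by (simp add: sum.distrib sum_subtractf X Y sum_distrib_left)
  also have "\<dots> = (\<Sum>t\<in>T. (x t)\<^sup>2 / y t) - X\<^sup>2 / Y"
    using XY by (cases "Y = 0") (auto simp: c_def power2_eq_square field_simps)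
  finally show ?thesis by (simp add: c_def)
qed

lemma sum_weighted_Cauchy_Schwarz:
  fixes y d :: "'t \<Rightarrow> real"
  assumes "\<And>t. t \<in> T \<Longrightarrow> 0 \<le> y t"
  shows "(\<Sum>t\<in>T. y t * d t)\<^sup>2 \<le> (\<Sum>t\<in>T. y t) * (\<Sum>t\<in>T. y t * (d t)\<^sup>2)"
proof -
  have "(\<Sum>t\<in>T. y t * d t) = (\<Sum>t\<in>T. sqrt (y t) * (sqrt (y t) * d t))"
    using assms by (intro sum.cong) (auto simp flip: mult.assoc)
  also have "\<dots>\<^sup>2 \<le> (\<Sum>t\<in>T. (sqrt (y t))\<^sup>2) * (\<Sum>t\<in>T. (sqrt (y t) * d t)\<^sup>2)"
    by (rule Cauchy_Schwarz_ineq_sum)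
  also have "\<dots> = (\<Sum>t\<in>T. y t) * (\<Sum>t\<in>T. y t * (d t)\<^sup>2)"
    using assms by (simp add: power_mult_distrib)
  finally show ?thesis .
qed

section \<open>Sums over the words of a given length\<close>

definition words :: "nat \<Rightarrow> 'a list set" where
  "words n = {w. length w = n}"

lemma finite_words [simp]: "finite (words n :: 'a::finite list set)"
  using finite_lists_length_eq[of "UNIV :: 'a set" n] by (simp add: words_def)

lemma words_0 [simp]: "words 0 = {[]}"
  by (auto simp: words_def)

lemma sum_words_append:
  fixes f :: "'a::finite list \<Rightarrow> 'b::comm_monoid_add"
  shows "(\<Sum>v\<in>words (i + j). f v) = (\<Sum>w\<in>words i. \<Sum>t\<in>words j. f (w @ t))"
proof -
  have "(\<Sum>w\<in>words i. \<Sum>t\<in>words j. f (w @ t)) = (\<Sum>(w, t)\<in>words i \<times> words j. f (w @ t))"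
    by (simp add: sum.cartesian_product)
  also have "\<dots> = (\<Sum>v\<in>words (i + j). f v)"
    by (rule sum.reindex_bij_witness[of _ "\<lambda>v. (take i v, drop i v)" "\<lambda>(w, t). w @ t"])
       (auto simp: words_def)
  finally show ?thesis by simp
qed

lemma sum_words_1:
  fixes f :: "'a::finite list \<Rightarrow> 'b::comm_monoid_add"
  shows "(\<Sum>v\<in>words (Suc 0). f v) = (\<Sum>b\<in>UNIV. f [b])"
  by (rule sum.reindex_bij_witness[of _ "\<lambda>b. [b]" hd]) (auto simp: words_def length_Suc_conv)

lemma sum_words_append_le:
  fixes f :: "'a::finite list \<Rightarrow> real"
  assumes "\<And>t. 0 \<le> f t" "length s + j = k"
  shows "(\<Sum>t\<in>words j. f (s @ t)) \<le> (\<Sum>t\<in>words k. f t)" (is ?A)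
    and "(\<Sum>t\<in>words j. f (t @ s)) \<le> (\<Sum>t\<in>words k. f t)" (is ?B)
proof -
  have "(\<Sum>t\<in>words j. f (s @ t)) = sum f ((\<lambda>t. s @ t) ` words j)"
    by (subst sum.reindex) (auto simp: inj_on_def)
  also have "\<dots> \<le> (\<Sum>t\<in>words k. f t)"
    using assms by (intro sum_mono2 finite_words) (auto simp: words_def)
  finally show ?A .
  have "(\<Sum>t\<in>words j. f (t @ s)) = sum f ((\<lambda>t. t @ s) ` words j)"
    by (subst sum.reindex) (auto simp: inj_on_def)
  also have "\<dots> \<le> (\<Sum>t\<in>words k. f t)"
    using assms by (intro sum_mono2 finite_words) (auto simp: words_def)
  finally show ?B .
qed

section \<open>Oscillation of functions on a finite group\<close>

lemma (in group) sum_carrier_translate: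
  assumes "h \<in> carrier G"
  shows "(\<Sum>g\<in>carrier G. f (g \<otimes> h)) = (\<Sum>g\<in>carrier G. f g)"
  by (rule sum.reindex_bij_witness[of _ "\<lambda>g. g \<otimes> inv h" "\<lambda>g. g \<otimes> h"])
     (use assms in \<open>auto simp: m_assoc\<close>)

text \<open>The step is by \<open>inv s\<close> because prefixing \<open>u\<close> to a word
  replaces the group element \<open>g\<close> by \<open>g \<otimes> inv (\<phi> u)\<close>.\<close>

definition (in group) right_step_bound :: "'a set \<Rightarrow> ('a \<Rightarrow> real) \<Rightarrow> real \<Rightarrow> bool" where
  "right_step_bound S f r \<longleftrightarrow> (\<forall>s\<in>S. \<forall>g\<in>carrier G. \<bar>f (g \<otimes> inv s) - f g\<bar> \<le> r)"

text \<open>Chaining steps along an expression of \<open>h\<close> in the generators gives a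
  constant for each pair of \<open>S\<close> and \<open>h\<close>. There are finitely many pairs, so
  one \<open>K\<close> serves all; this matters because the generating set of returns varies with
  \<open>w\<close>.\<close>

lemma (in group) generated_oscillation_bound:
  assumes fin: "finite (carrier G)"
  obtains K where "0 \<le> K"
    and "\<And>S f r h g. generate G S = carrier G \<Longrightarrow> S \<subseteq> carrier G \<Longrightarrow> 0 \<le> r \<Longrightarrow> right_step_bound S f r \<Longrightarrow>
      h \<in> carrier G \<Longrightarrow> g \<in> carrier G \<Longrightarrow> \<bar>f (g \<otimes> h) - f g\<bar> \<le> K * r"
proof -
  define P where "P S h k \<longleftrightarrow> 0 \<le> k \<and>
     (\<forall>f r g. 0 \<le> r \<longrightarrow> right_step_bound S f r \<longrightarrow> g \<in> carrier G \<longrightarrow> \<bar>f (g \<otimes> h) - f g\<bar> \<le> k * r)"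
    for S :: "'a set" and h and k :: real
  have P_intro: "P S h k" if "0 \<le> k"
    "\<And>f r g. 0 \<le> r \<Longrightarrow> right_step_bound S f r \<Longrightarrow> g \<in> carrier G \<Longrightarrow> \<bar>f (g \<otimes> h) - f g\<bar> \<le> k * r" for S h k
    unfolding P_def by (intro conjI allI impI; rule that; assumption)
  have P_dest: "\<bar>f (g \<otimes> h) - f g\<bar> \<le> k * r"
    if "P S h k" "0 \<le> r" "right_step_bound S f r" "g \<in> carrier G" for S h k f r g
    using that(1)[unfolded P_def, THEN conjunct2, rule_format, of r f g] that(2-) .
  have ex: "\<exists>k. P S h k" if S: "S \<subseteq> carrier G" and h: "h \<in> generate G S" for S h
    using h
  proof (induction rule: generate.induct)
    case one
    have "P S \<one> 0" by (rule P_intro) auto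
    then show ?case ..
  next
    case (incl h)
    then have hc: "h \<in> carrier G" using S by auto
    have "P S h 1"
    proof (rule P_intro)
      fix f :: "'a \<Rightarrow> real" and r g
      assume *: "right_step_bound S f r" "g \<in> carrier G"
      \<comment> \<open>A step by \<open>h\<close> from \<open>g\<close> is, reversed, a step by
        \<open>inv h\<close> from \<open>g \<otimes> h\<close>.\<close>
      have "\<bar>f ((g \<otimes> h) \<otimes> inv h) - f (g \<otimes> h)\<bar> \<le> r"
        using *(1)[unfolded right_step_bound_def, rule_format, OF incl] * hc by simp
      then show "\<bar>f (g \<otimes> h) - f g\<bar> \<le> 1 * r"
        using * hc by (simp add: m_assoc abs_minus_commute)
    qed simp
    then show ?case ..
  next
    case (inv h)
    have "P S (inv h) 1"
      by (rule P_intro) (use inv in \<open>simp_all add: right_step_bound_def\<close>)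
    then show ?case ..
  next
    case (eng h1 h2)
    obtain k1 k2 where k: "P S h1 k1" "P S h2 k2" using eng.IH by blast
    have hc: "h1 \<in> carrier G" "h2 \<in> carrier G" using eng.hyps generate_in_carrier[OF S] by auto
    have "P S (h1 \<otimes> h2) (k1 + k2)"
    proof (rule P_intro)
      show "0 \<le> k1 + k2" using k by (simp add: P_def)
      fix f :: "'a \<Rightarrow> real" and r g
      assume *: "0 \<le> r" "right_step_bound S f r" "g \<in> carrier G"
      have "\<bar>f (g \<otimes> h1) - f g\<bar> \<le> k1 * r" using P_dest[OF k(1) *] .
      moreover have "\<bar>f ((g \<otimes> h1) \<otimes> h2) - f (g \<otimes> h1)\<bar> \<le> k2 * r"
        using P_dest[OF k(2) *(1,2), of "g \<otimes> h1"] * hc by simp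
      ultimately show "\<bar>f (g \<otimes> (h1 \<otimes> h2)) - f g\<bar> \<le> (k1 + k2) * r"
        using * hc by (simp add: m_assoc distrib_right)
    qed
    then show ?case ..
  qed
  define k where "k S h = (SOME k. P S h k)" for S h
  have k: "P S h (k S h)" if "S \<subseteq> carrier G" "h \<in> generate G S" for S h
    unfolding k_def using ex[OF that] by (rule someI_ex)
  define GS where "GS = {S. S \<subseteq> carrier G \<and> generate G S = carrier G}"
  define K where "K = (\<Sum>x\<in>GS \<times> carrier G. k (fst x) (snd x))"
  have fGS: "finite GS" by (rule finite_subset[of _ "Pow (carrier G)"]) (use fin in \<open>auto simp: GS_def\<close>)
  have nn: "0 \<le> k S h" if "S \<in> GS" "h \<in> carrier G" for S h
    using k[of S h] that by (simp add: GS_def P_def)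
  have kK: "k S h \<le> K" if "S \<in> GS" "h \<in> carrier G" for S h
    unfolding K_def using nn fGS fin that
    by (intro member_le_sum[of "(S, h)" _ "\<lambda>x. k (fst x) (snd x)", simplified]) auto
  have K0: "0 \<le> K" unfolding K_def using nn by (intro sum_nonneg) auto
  show ?thesis
  proof (rule that[OF K0])
    fix S and f :: "'a \<Rightarrow> real" and r h g
    assume *: "generate G S = carrier G" "S \<subseteq> carrier G" "0 \<le> r" "right_step_bound S f r"
      "h \<in> carrier G" "g \<in> carrier G"
    have "\<bar>f (g \<otimes> h) - f g\<bar> \<le> k S h * r" using * by (intro P_dest[OF k]) auto
    also have "\<dots> \<le> K * r" using kK[of S h] * by (intro mult_right_mono) (auto simp: GS_def)
    finally show "\<bar>f (g \<otimes> h) - f g\<bar> \<le> K * r" .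
  qed
qed

text \<open>\<open>q_right\<close> is additivity over cylinders, \<open>q_left\<close> is invariance
  under the skew product that multiplies the group coordinate by the image of the first letter and
  shifts the sequence, and \<open>q_sum\<close> is the projection to the base.\<close>

locale skew_weights = group G for G :: "('g, 'b) monoid_scheme" (structure) +
  fixes \<phi> :: "'a::finite list \<Rightarrow> 'g" and m :: "'a list \<Rightarrow> real" and q :: "'g \<Rightarrow> 'a list \<Rightarrow> real"
  assumes fin: "finite (carrier G)"
    and hom: "\<phi> \<in> monoid_hom free_monoid G"
    and q_nonneg: "g \<in> carrier G \<Longrightarrow> 0 \<le> q g w"
    and q_sum: "(\<Sum>g\<in>carrier G. q g w) = m w"
    and q_right: "g \<in> carrier G \<Longrightarrow> q g w = (\<Sum>b\<in>UNIV. q g (w @ [b]))"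
    and q_left: "g \<in> carrier G \<Longrightarrow> q g w = (\<Sum>a\<in>UNIV. q (g \<otimes> inv (\<phi> [a])) (a # w))"
    and m_Nil: "m [] = 1"
begin

lemmas hom_append = monoid_hom_free_append[OF hom]
lemmas hom_closed [simp] = monoid_hom_free_closed[OF hom]
lemmas hom_Nil [simp] = monoid_hom_free_Nil[OF hom]

lemma m_nonneg: "0 \<le> m w"
  using q_nonneg by (simp add: q_sum[symmetric] sum_nonneg)

lemma q_le_m: "g \<in> carrier G \<Longrightarrow> q g w \<le> m w"
  unfolding q_sum[symmetric] using fin q_nonneg by (intro member_le_sum) auto

lemma q_zero: "g \<in> carrier G \<Longrightarrow> m w = 0 \<Longrightarrow> q g w = 0"
  using q_le_m[of g w] q_nonneg[of g w] by simp

lemma q_right_words: "g \<in> carrier G \<Longrightarrow> q g w = (\<Sum>t\<in>words k. q g (w @ t))"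
proof (induction k)
  case (Suc k)
  have "q g w = (\<Sum>t\<in>words k. \<Sum>b\<in>UNIV. q g (w @ t @ [b]))"
    unfolding Suc.IH[OF Suc.prems] by (intro sum.cong refl) (subst q_right[OF Suc.prems], simp)
  also have "\<dots> = (\<Sum>t\<in>words (Suc k). q g (w @ t))"
    using sum_words_append[of "\<lambda>t. q g (w @ t)" k "Suc 0"] by (simp add: sum_words_1)
  finally show ?case .
qed simp

lemma q_left_words: "g \<in> carrier G \<Longrightarrow> q g w = (\<Sum>t\<in>words k. q (g \<otimes> inv (\<phi> t)) (t @ w))"
proof (induction k arbitrary: g w)
  case (Suc k)
  have "q g w = (\<Sum>a\<in>UNIV. \<Sum>t\<in>words k. q (g \<otimes> inv (\<phi> [a]) \<otimes> inv (\<phi> t)) (t @ a # w))"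
    by (subst q_left[OF Suc.prems], intro sum.cong refl Suc.IH) (use Suc.prems in auto)
  also have "\<dots> = (\<Sum>t\<in>words k. \<Sum>a\<in>UNIV. q (g \<otimes> inv (\<phi> (t @ [a]))) ((t @ [a]) @ w))"
    using Suc.prems by (subst sum.swap) (simp add: hom_append inv_mult_group m_assoc)
  also have "\<dots> = (\<Sum>t\<in>words (Suc k). q (g \<otimes> inv (\<phi> t)) (t @ w))"
    using sum_words_append[of "\<lambda>t. q (g \<otimes> inv (\<phi> t)) (t @ w)" k "Suc 0"] by (simp add: sum_words_1)
  finally show ?case .
qed simp

lemma m_right_words: "m w = (\<Sum>t\<in>words k. m (w @ t))"
proof -
  have "m w = (\<Sum>g\<in>carrier G. \<Sum>t\<in>words k. q g (w @ t))"
    unfolding q_sum[of w, symmetric] by (intro sum.cong refl q_right_words)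
  also have "\<dots> = (\<Sum>t\<in>words k. m (w @ t))" by (subst sum.swap) (simp add: q_sum)
  finally show ?thesis .
qed

lemma sum_translate_inv: "(\<Sum>g\<in>carrier G. f (g \<otimes> inv (\<phi> t))) = (\<Sum>g\<in>carrier G. f g)"
  by (rule sum_carrier_translate) simp

lemma m_left_words: "m w = (\<Sum>t\<in>words k. m (t @ w))"
proof -
  have "m w = (\<Sum>g\<in>carrier G. \<Sum>t\<in>words k. q (g \<otimes> inv (\<phi> t)) (t @ w))"
    unfolding q_sum[of w, symmetric] by (intro sum.cong refl q_left_words)
  also have "\<dots> = (\<Sum>t\<in>words k. m (t @ w))"
    by (subst sum.swap) (simp add: q_sum sum_translate_inv[of "\<lambda>g. q g _"])
  finally show ?thesis .
qed

lemma sum_m_words: "(\<Sum>w\<in>words n. m w) = 1"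
  using m_right_words[of "[]" n] m_Nil by simp

text \<open>The conditional probability of \<open>g\<close> given the cylinder of \<open>w\<close>,
  with value 0 on null cylinders.\<close>

definition Q :: "'g \<Rightarrow> 'a list \<Rightarrow> real" where "Q g w = q g w / m w"

text \<open>The mean square of \<open>Q\<close> over the cylinders of length \<open>n\<close>,
  summed over the group, since \<open>m w * (Q g w)\<^sup>2\<close> equals the summand.\<close>

definition energy :: "nat \<Rightarrow> real" where
  "energy n = (\<Sum>w\<in>words n. \<Sum>g\<in>carrier G. (q g w)\<^sup>2 / m w)"

definition right_dev :: "nat \<Rightarrow> 'a list \<Rightarrow> real" where
  "right_dev k w = (\<Sum>t\<in>words k. \<Sum>g\<in>carrier G. m (w @ t) * (Q g (w @ t) - Q g w)\<^sup>2)"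

text \<open>The twist by \<open>inv (\<phi> t)\<close> is that of \<open>q_left\<close>: reading
  \<open>t\<close> from the twisted element leads to \<open>g\<close> at the start of
  \<open>w\<close>.\<close>

definition left_dev :: "nat \<Rightarrow> 'a list \<Rightarrow> real" where
  "left_dev k w = (\<Sum>t\<in>words k. \<Sum>g\<in>carrier G. m (t @ w) * (Q (g \<otimes> inv (\<phi> t)) (t @ w) - Q g w)\<^sup>2)"

lemma m_Q: "g \<in> carrier G \<Longrightarrow> m w * Q g w = q g w"
  using q_zero by (auto simp: Q_def)

lemma right_dev_nonneg: "0 \<le> right_dev k w"
  unfolding right_dev_def using m_nonneg by (intro sum_nonneg) auto

lemma left_dev_nonneg: "0 \<le> left_dev k w"
  unfolding left_dev_def using m_nonneg by (intro sum_nonneg) auto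

text \<open>For fixed \<open>g\<close>, both \<open>q g\<close> and \<open>m\<close> at
  \<open>w\<close> are the sums of their values at the extensions, so the variance identity
  applies.\<close>

lemma right_dev_eq:
  "right_dev k w = (\<Sum>t\<in>words k. \<Sum>g\<in>carrier G. (q g (w @ t))\<^sup>2 / m (w @ t)) - (\<Sum>g\<in>carrier G. (q g w)\<^sup>2 / m w)"
proof -
  have "right_dev k w = (\<Sum>g\<in>carrier G. \<Sum>t\<in>words k. m (w @ t) * (Q g (w @ t) - Q g w)\<^sup>2)"
    unfolding right_dev_def by (rule sum.swap)
  also have "\<dots> = (\<Sum>g\<in>carrier G. (\<Sum>t\<in>words k. (q g (w @ t))\<^sup>2 / m (w @ t)) - (q g w)\<^sup>2 / m w)"
    unfolding Q_def
    by (intro sum.cong refl sum_weighted_deviation q_right_words m_right_words) (auto intro: q_zero)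
  also have "\<dots> = (\<Sum>t\<in>words k. \<Sum>g\<in>carrier G. (q g (w @ t))\<^sup>2 / m (w @ t)) - (\<Sum>g\<in>carrier G. (q g w)\<^sup>2 / m w)"
    unfolding sum_subtractf by (subst sum.swap) simp
  finally show ?thesis .
qed

text \<open>As on the right; the twist disappears in the sum over the group, which is invariant
  under translation.\<close>

lemma left_dev_eq:
  "left_dev k w = (\<Sum>t\<in>words k. \<Sum>g\<in>carrier G. (q g (t @ w))\<^sup>2 / m (t @ w)) - (\<Sum>g\<in>carrier G. (q g w)\<^sup>2 / m w)"
proof -
  have "left_dev k w = (\<Sum>g\<in>carrier G. \<Sum>t\<in>words k. m (t @ w) * (Q (g \<otimes> inv (\<phi> t)) (t @ w) - Q g w)\<^sup>2)"
    unfolding left_dev_def by (rule sum.swap)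
  also have "\<dots> = (\<Sum>g\<in>carrier G. (\<Sum>t\<in>words k. (q (g \<otimes> inv (\<phi> t)) (t @ w))\<^sup>2 / m (t @ w)) - (q g w)\<^sup>2 / m w)"
    unfolding Q_def
    by (intro sum.cong refl sum_weighted_deviation q_left_words m_left_words) (auto intro: q_zero)
  also have "\<dots> = (\<Sum>t\<in>words k. \<Sum>g\<in>carrier G. (q (g \<otimes> inv (\<phi> t)) (t @ w))\<^sup>2 / m (t @ w)) - (\<Sum>g\<in>carrier G. (q g w)\<^sup>2 / m w)"
    unfolding sum_subtractf by (subst sum.swap) simp
  also have "(\<Sum>t\<in>words k. \<Sum>g\<in>carrier G. (q (g \<otimes> inv (\<phi> t)) (t @ w))\<^sup>2 / m (t @ w)) =
             (\<Sum>t\<in>words k. \<Sum>g\<in>carrier G. (q g (t @ w))\<^sup>2 / m (t @ w))"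
    by (rule sum.cong[OF refl], rule sum_translate_inv)
  finally show ?thesis .
qed

lemma sum_right_dev: "(\<Sum>w\<in>words n. right_dev k w) = energy (n + k) - energy n"
  unfolding right_dev_eq energy_def sum_words_append sum_subtractf ..

text \<open>Words \<open>t @ w\<close> and \<open>w @ t\<close> run through the same words of length
  \<open>n + k\<close>, so left and right refinement gain the same energy.\<close>

lemma sum_left_dev: "(\<Sum>w\<in>words n. left_dev k w) = energy (n + k) - energy n"
  unfolding left_dev_eq energy_def add.commute[of n k] sum_words_append sum_subtractf
  by (subst sum.swap) simp

lemma energy_mono: "energy n \<le> energy (n + k)"
  using sum_right_dev[of k n] right_dev_nonneg by (metis diff_ge_0_iff_ge sum_nonneg)

lemma energy_le_1: "energy n \<le> 1"
proof -
  have "energy n \<le> (\<Sum>w\<in>words n. \<Sum>g\<in>carrier G. q g w)"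
    unfolding energy_def
  proof (intro sum_mono)
    fix w g assume g: "g \<in> carrier G"
    have "q g w * q g w \<le> q g w * m w" using q_le_m[OF g] q_nonneg[OF g] by (rule mult_left_mono)
    then show "(q g w)\<^sup>2 / m w \<le> q g w"
      using m_nonneg[of w] q_nonneg[OF g, of w] by (cases "m w = 0") (auto simp: power2_eq_square divide_simps)
  qed
  also have "\<dots> = 1" by (simp add: q_sum sum_m_words)
  finally show ?thesis .
qed

text \<open>If \<open>s\<close> is shorter than \<open>k\<close>, then \<open>Q g (w @ s)\<close> is
  the weighted mean of \<open>Q g\<close> over the continuations of \<open>w @ s\<close> of length
  \<open>length w + k\<close>; by Cauchy-Schwarz it deviates no more than they do.\<close>

lemma right_dev_bound:
  assumes g: "g \<in> carrier G" and s: "length s \<le> k" and pos: "0 < m (w @ s)"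
  shows "m (w @ s) * (Q g (w @ s) - Q g w)\<^sup>2 \<le> right_dev k w"
proof -
  let ?W = "words (k - length s)"
  let ?f = "\<lambda>t. m (w @ t) * (Q g (w @ t) - Q g w)\<^sup>2"
  have ms: "m (w @ s) = (\<Sum>t\<in>?W. m (w @ s @ t))"
    using m_right_words[of "w @ s" "k - length s"] by simp
  have qs: "q g (w @ s) = (\<Sum>t\<in>?W. q g (w @ s @ t))"
    using q_right_words[OF g, of "w @ s" "k - length s"] by simp
  have "m (w @ s) * (Q g (w @ s) - Q g w) = (\<Sum>t\<in>?W. m (w @ s @ t) * (Q g (w @ s @ t) - Q g w))"
    unfolding right_diff_distrib m_Q[OF g] sum_subtractf sum_distrib_right[symmetric] qs ms[symmetric] ..
  then have "(m (w @ s) * (Q g (w @ s) - Q g w))\<^sup>2 \<le> m (w @ s) * (\<Sum>t\<in>?W. ?f (s @ t))"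
    using sum_weighted_Cauchy_Schwarz[of ?W "\<lambda>t. m (w @ s @ t)" "\<lambda>t. Q g (w @ s @ t) - Q g w"] m_nonneg
    by (simp only: ms[symmetric])
  then have "m (w @ s) * (m (w @ s) * (Q g (w @ s) - Q g w)\<^sup>2) \<le> m (w @ s) * (\<Sum>t\<in>?W. ?f (s @ t))"
    by (simp only: power2_eq_square mult.assoc mult.left_commute)
  then have "m (w @ s) * (Q g (w @ s) - Q g w)\<^sup>2 \<le> (\<Sum>t\<in>?W. ?f (s @ t))"
    using pos by simp
  also have "\<dots> \<le> (\<Sum>t\<in>words k. ?f t)"
    using m_nonneg s by (intro sum_words_append_le(1)) auto
  also have "\<dots> \<le> right_dev k w"
    unfolding right_dev_def
  proof (rule sum_mono)
    fix t
    show "?f t \<le> (\<Sum>g\<in>carrier G. m (w @ t) * (Q g (w @ t) - Q g w)\<^sup>2)"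
      using fin g m_nonneg by (intro member_le_sum[of g _ "\<lambda>g. m (w @ t) * (Q g (w @ t) - Q g w)\<^sup>2"]) auto
  qed
  finally show ?thesis .
qed

text \<open>The same averaging over continuations to the left; the twists by \<open>u\<close> and
  \<open>t\<close> combine to that by \<open>t @ u\<close>.\<close>

lemma left_dev_bound:
  assumes g: "g \<in> carrier G" and u: "length u \<le> k" and pos: "0 < m (u @ w)"
  shows "m (u @ w) * (Q (g \<otimes> inv (\<phi> u)) (u @ w) - Q g w)\<^sup>2 \<le> left_dev k w"
proof -
  let ?W = "words (k - length u)"
  let ?h = "\<lambda>t. g \<otimes> inv (\<phi> t)"
  let ?f = "\<lambda>t. m (t @ w) * (Q (?h t) (t @ w) - Q g w)\<^sup>2"
  have h: "?h t \<in> carrier G" for t using g by simp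
  have inv: "?h u \<otimes> inv (\<phi> t) = ?h (t @ u)" for t
    using g by (simp add: hom_append inv_mult_group m_assoc)
  have ms: "m (u @ w) = (\<Sum>t\<in>?W. m (t @ u @ w))" by (rule m_left_words)
  have qs: "q (?h u) (u @ w) = (\<Sum>t\<in>?W. q (?h (t @ u)) (t @ u @ w))"
    using q_left_words[OF h, of u "u @ w" "k - length u"] by (simp only: inv)
  have "m (u @ w) * (Q (?h u) (u @ w) - Q g w) =
      (\<Sum>t\<in>?W. m (t @ u @ w) * (Q (?h (t @ u)) (t @ u @ w) - Q g w))"
    unfolding right_diff_distrib m_Q[OF h] sum_subtractf sum_distrib_right[symmetric] qs ms[symmetric] ..
  then have "(m (u @ w) * (Q (?h u) (u @ w) - Q g w))\<^sup>2 \<le> m (u @ w) * (\<Sum>t\<in>?W. ?f (t @ u))"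
    using sum_weighted_Cauchy_Schwarz[of ?W "\<lambda>t. m (t @ u @ w)" "\<lambda>t. Q (?h (t @ u)) (t @ u @ w) - Q g w"] m_nonneg
    by (simp only: ms[symmetric] append_assoc)
  then have "m (u @ w) * (m (u @ w) * (Q (?h u) (u @ w) - Q g w)\<^sup>2) \<le> m (u @ w) * (\<Sum>t\<in>?W. ?f (t @ u))"
    by (simp only: power2_eq_square mult.assoc mult.left_commute)
  then have "m (u @ w) * (Q (?h u) (u @ w) - Q g w)\<^sup>2 \<le> (\<Sum>t\<in>?W. ?f (t @ u))"
    using pos by simp
  also have "\<dots> \<le> (\<Sum>t\<in>words k. ?f t)"
    using m_nonneg u by (intro sum_words_append_le(2)) auto
  also have "\<dots> \<le> left_dev k w"
    unfolding left_dev_def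
  proof (rule sum_mono)
    fix t
    show "?f t \<le> (\<Sum>g\<in>carrier G. m (t @ w) * (Q (g \<otimes> inv (\<phi> t)) (t @ w) - Q g w)\<^sup>2)"
      using fin g m_nonneg
      by (intro member_le_sum[of g _ "\<lambda>g. m (t @ w) * (Q (g \<otimes> inv (\<phi> t)) (t @ w) - Q g w)\<^sup>2"]) auto
  qed
  finally show ?thesis .
qed

theorem q_Nil_uniform:
  assumes \<delta>: "0 < \<delta>" and D: "1 \<le> D"
    and ratio: "\<And>w v. w \<noteq> [] \<Longrightarrow> 0 < m w \<Longrightarrow> 0 < m v \<Longrightarrow> length v \<le> D * length w \<Longrightarrow> \<delta> * m w \<le> m v"
    and gen: "\<And>w. w \<noteq> [] \<Longrightarrow> 0 < m w \<Longrightarrow>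
       generate G (\<phi> ` close_returns {v. 0 < m v} w (D * length w)) = carrier G"
    and g: "g \<in> carrier G"
  shows "q g [] = 1 / card (carrier G)"
proof -
  obtain K where K: "0 \<le> K" "\<And>S f r h g. generate G S = carrier G \<Longrightarrow> S \<subseteq> carrier G \<Longrightarrow> 0 \<le> r \<Longrightarrow>
     right_step_bound S f r \<Longrightarrow> h \<in> carrier G \<Longrightarrow> g \<in> carrier G \<Longrightarrow> \<bar>f (g \<otimes> h) - f g\<bar> \<le> K * r"
    using generated_oscillation_bound[OF fin] by metis
  define c where "c = real (card (carrier G))"
  have c: "0 < c" using g fin by (auto simp: c_def card_gt_0_iff)
  \<comment> \<open>The defect is bounded by the energy gained between lengths \<open>n\<close> and
    \<open>D * n\<close>, with constants independent of \<open>n\<close>.\<close>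
  have main: "\<bar>q g [] - 1 / c\<bar> \<le> K * sqrt (4 / \<delta> * (energy (D * n) - energy n))" if n: "1 \<le> n" for n
  proof -
    define k where "k = D * n - n"
    have nk: "n + k = D * n" using D by (simp add: k_def)
    \<comment> \<open>\<open>r w\<close> bounds one step of \<open>Q _ w\<close> along a return: the
      factor 2 is from \<open>square_diff_le\<close>, and \<open>\<delta> * m w\<close> bounds the
      mass of \<open>u @ w\<close> from below.\<close>
    define r where "r w = sqrt (2 * (right_dev k w + left_dev k w) / (\<delta> * m w))" for w
    have r0: "0 \<le> r w" for w unfolding r_def
      using right_dev_nonneg left_dev_nonneg m_nonneg \<delta> by (intro real_sqrt_ge_zero divide_nonneg_nonneg) auto
    have near: "\<bar>Q g w - 1 / c\<bar> \<le> K * r w" if w: "length w = n" "0 < m w" for w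
    proof -
      have ne: "w \<noteq> []" using w n by auto
      have step: "\<bar>Q (g \<otimes> inv s) w - Q g w\<bar> \<le> r w"
        if s: "s \<in> \<phi> ` close_returns {v. 0 < m v} w (D * length w)" and g: "g \<in> carrier G" for s g
      proof -
        obtain u where u: "s = \<phi> u" "0 < m (u @ w)" "prefix w (u @ w)" "length (u @ w) \<le> D * n"
          using s w by (auto simp: close_returns_def)
        obtain t where t: "u @ w = w @ t" using u(3) by (auto simp: prefix_def)
        have lt: "length t = length u" using arg_cong[OF t, of length] by simp
        have lu: "length u \<le> k" using u(4) w nk by simp
        \<comment> \<open>As the right extension \<open>w @ t\<close>, the word \<open>u @ w\<close>
          links \<open>A\<close> to \<open>Q (g \<otimes> inv s) w\<close>; as a left extension of
          \<open>w\<close>, it links \<open>A\<close> to \<open>Q g w\<close>.\<close>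
        define A where "A = Q (g \<otimes> inv s) (u @ w)"
        have "m (u @ w) * (A - Q (g \<otimes> inv s) w)\<^sup>2 \<le> right_dev k w"
          using right_dev_bound[of "g \<otimes> inv s" t k w] g lt lu u by (simp add: t A_def)
        moreover have "m (u @ w) * (A - Q g w)\<^sup>2 \<le> left_dev k w"
          using left_dev_bound[of g u k w] g lu u by (simp add: A_def)
        moreover have "(Q (g \<otimes> inv s) w - Q g w)\<^sup>2 \<le> 2 * ((A - Q (g \<otimes> inv s) w)\<^sup>2 + (A - Q g w)\<^sup>2)"
          by (rule square_diff_le)
        then have "m (u @ w) * (Q (g \<otimes> inv s) w - Q g w)\<^sup>2
            \<le> m (u @ w) * (2 * ((A - Q (g \<otimes> inv s) w)\<^sup>2 + (A - Q g w)\<^sup>2))"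
          using u(2) by (intro mult_left_mono) auto
        ultimately have "m (u @ w) * (Q (g \<otimes> inv s) w - Q g w)\<^sup>2 \<le> 2 * (right_dev k w + left_dev k w)"
          by (simp add: distrib_left)
        moreover have "\<delta> * m w \<le> m (u @ w)" using ratio[OF ne w(2) u(2)] u(4) w by simp
        ultimately have "(\<delta> * m w) * (Q (g \<otimes> inv s) w - Q g w)\<^sup>2 \<le> 2 * (right_dev k w + left_dev k w)"
          by (meson mult_right_mono order_trans zero_le_power2)
        then have "(Q (g \<otimes> inv s) w - Q g w)\<^sup>2 \<le> 2 * (right_dev k w + left_dev k w) / (\<delta> * m w)"
          using w \<delta> by (simp add: pos_le_divide_eq mult.commute)
        then show ?thesis unfolding r_def by (metis real_sqrt_abs real_sqrt_le_iff)
      qed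
      have sb: "right_step_bound (\<phi> ` close_returns {v. 0 < m v} w (D * length w)) (\<lambda>g. Q g w) (r w)"
        unfolding right_step_bound_def using step by blast
      have osc: "\<bar>Q g' w - Q g w\<bar> \<le> K * r w" if g': "g' \<in> carrier G" for g'
      proof -
        have "\<bar>Q (g \<otimes> (inv g \<otimes> g')) w - Q g w\<bar> \<le> K * r w"
          by (rule K(2)[OF gen[OF ne w(2)] _ r0 sb]) (use g g' in auto)
        then show ?thesis using g g' by (simp add: m_assoc[symmetric])
      qed
      \<comment> \<open>The mean of \<open>Q _ w\<close> over the group is \<open>1 / c\<close>, so
        small oscillation means closeness to \<open>1 / c\<close>.\<close>
      have "(\<Sum>g'\<in>carrier G. Q g' w) = 1" using q_sum[of w] w by (simp add: Q_def sum_divide_distrib[symmetric])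
      then have "1 - c * Q g w = (\<Sum>g'\<in>carrier G. Q g' w - Q g w)" by (simp add: sum_subtractf c_def)
      also have "\<bar>\<dots>\<bar> \<le> (\<Sum>g'\<in>carrier G. K * r w)" by (rule sum_abs[THEN order_trans]) (intro sum_mono osc)
      also have "\<dots> = c * (K * r w)" by (simp add: c_def)
      finally have "\<bar>c * (1 / c - Q g w)\<bar> \<le> c * (K * r w)" using c by (simp add: right_diff_distrib)
      then have "\<bar>1 / c - Q g w\<bar> \<le> K * r w" using c by (simp add: abs_mult)
      then show ?thesis by linarith
    qed
    have "q g [] - 1 / c = (\<Sum>w\<in>words n. q g w) - (\<Sum>w\<in>words n. m w) / c"
      using q_right_words[OF g, of "[]" n] by (simp add: sum_m_words)
    also have "\<dots> = (\<Sum>w\<in>words n. m w * (Q g w - 1 / c))"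
      by (simp add: right_diff_distrib m_Q[OF g] sum_subtractf sum_divide_distrib)
    also have "\<bar>\<dots>\<bar> \<le> (\<Sum>w\<in>words n. K * (sqrt (m w) * sqrt (2 / \<delta> * (right_dev k w + left_dev k w))))"
    proof (rule sum_abs[THEN order_trans], intro sum_mono)
      fix w :: "'a list" assume w: "w \<in> words n"
      show "\<bar>m w * (Q g w - 1 / c)\<bar> \<le> K * (sqrt (m w) * sqrt (2 / \<delta> * (right_dev k w + left_dev k w)))"
      proof (cases "m w = 0")
        case False
        then have pos: "0 < m w" using m_nonneg[of w] by simp
        have "\<bar>m w * (Q g w - 1 / c)\<bar> \<le> m w * (K * r w)"
          using near[of w] w pos by (simp add: abs_mult words_def)
        also have "\<dots> = K * (sqrt (m w) * (sqrt (m w) * r w))" using pos by simp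
        also have "sqrt (m w) * r w = sqrt (2 / \<delta> * (right_dev k w + left_dev k w))"
          unfolding r_def real_sqrt_mult[symmetric] using pos \<delta> by (simp add: field_simps)
        finally show ?thesis .
      qed simp
    qed
    also have "\<dots> = K * (\<Sum>w\<in>words n. sqrt (m w) * sqrt (2 / \<delta> * (right_dev k w + left_dev k w)))"
      by (simp add: sum_distrib_left)
    also have "(\<Sum>w\<in>words n. sqrt (m w) * sqrt (2 / \<delta> * (right_dev k w + left_dev k w)))
        \<le> sqrt (4 / \<delta> * (energy (D * n) - energy n))"
    proof (rule real_le_rsqrt)
      \<comment> \<open>The masses sum to 1, and left and right deviations each sum to the energy
        gain, which turns \<open>2 / \<delta>\<close> into \<open>4 / \<delta>\<close>.\<close>
      have "(\<Sum>w\<in>words n. sqrt (m w) * sqrt (2 / \<delta> * (right_dev k w + left_dev k w)))\<^sup>2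
        \<le> (\<Sum>w\<in>words n. (sqrt (m w))\<^sup>2) * (\<Sum>w\<in>words n. (sqrt (2 / \<delta> * (right_dev k w + left_dev k w)))\<^sup>2)"
        by (rule Cauchy_Schwarz_ineq_sum)
      also have "\<dots> = (\<Sum>w\<in>words n. m w) * (\<Sum>w\<in>words n. 2 / \<delta> * (right_dev k w + left_dev k w))"
        using m_nonneg right_dev_nonneg left_dev_nonneg \<delta> by simp
      also have "\<dots> = 2 / \<delta> * ((\<Sum>w\<in>words n. right_dev k w) + (\<Sum>w\<in>words n. left_dev k w))"
        unfolding sum_m_words sum_distrib_left[symmetric] sum.distrib by simp
      also have "\<dots> = 4 / \<delta> * (energy (D * n) - energy n)"
        unfolding sum_right_dev sum_left_dev nk by simp
      finally show "(\<Sum>w\<in>words n. sqrt (m w) * sqrt (2 / \<delta> * (right_dev k w + left_dev k w)))\<^sup>2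
         \<le> 4 / \<delta> * (energy (D * n) - energy n)" .
    qed
    finally show ?thesis using K(1) by (simp add: mult_left_mono)
  qed
  \<comment> \<open>Along the lengths \<open>D ^ j\<close> the energy is nondecreasing and bounded,
    so its increments tend to 0.\<close>
  define e where "e j = energy (D ^ j)" for j
  have "e j \<le> e (Suc j)" for j
    using energy_mono[of "D ^ j" "D * D ^ j - D ^ j"] D by (simp add: e_def)
  then have "incseq e" by (rule incseq_SucI)
  moreover have "\<forall>j. e j \<le> 1" by (simp add: e_def energy_le_1)
  ultimately obtain l where l: "e \<longlonglongrightarrow> l" by (rule incseq_convergent)
  have "(\<lambda>j. K * sqrt (4 / \<delta> * (e (Suc j) - e j))) \<longlonglongrightarrow> K * sqrt (4 / \<delta> * (l - l))"
    by (intro tendsto_mult tendsto_const tendsto_real_sqrt tendsto_diff l LIMSEQ_Suc[OF l])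
  moreover have "\<bar>q g [] - 1 / c\<bar> \<le> K * sqrt (4 / \<delta> * (e (Suc j) - e j))" for j
    using main[of "D ^ j"] D by (simp add: e_def)
  ultimately have "\<bar>q g [] - 1 / c\<bar> \<le> K * sqrt (4 / \<delta> * (l - l))"
    by (intro LIMSEQ_le_const) auto
  then show ?thesis by (simp add: c_def)
qed

end

section \<open>Measures of cylinders\<close>

lemma subword_append_eq:
  assumes "subword x i j = p @ w @ s"
  shows "subword x (i + int (length p)) (i + int (length p) + int (length w)) = w"
proof (rule nth_equalityI)
  fix k assume "k < length (subword x (i + int (length p)) (i + int (length p) + int (length w)))"
  then have k: "k < length w" by simp
  have l: "nat (j - i) = length p + length w + length s" using arg_cong[OF assms, of length] by simp
  have "(p @ w @ s) ! (length p + k) = x (i + int (length p + k))"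
    unfolding assms[symmetric] subword_eq_map using k l by simp
  then show "subword x (i + int (length p)) (i + int (length p) + int (length w)) ! k = w ! k"
    using k by (simp add: subword_eq_map nth_append add.assoc)
qed simp

lemma subword_snoc: "subword x i (i + int (Suc n)) = subword x i (i + int n) @ [x (i + int n)]"
  using subword_append[of i "i + int n" "i + int (Suc n)" x] subword_single[of x "i + int n"]
  by (simp add: algebra_simps)

lemma subword_Cons: "subword x i (i + int (Suc n)) = x i # subword x (i + 1) (i + 1 + int n)"
  using subword_append[of i "i + 1" "i + int (Suc n)" x] subword_single[of x i]
  by (simp add: algebra_simps)

lemma subword_shift_map: "subword (shift_map x) i j = subword x (i + 1) (j + 1)"
  by (simp add: subword_eq_map shift_map_def algebra_simps)

text \<open>If no left extension of a right special \<open>v\<close> were right special, every left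
  vertex of the extension graph of \<open>v\<close> would have at most one neighbour, and two right
  vertices could not be connected.\<close>

lemma dendric_right_special:
  assumes den: "dendric X" and letters: "\<And>a. [a] \<in> language X" and ab: "a0 \<noteq> (b0 :: 'a)"
  shows "\<exists>v a b. length v = n \<and> a \<noteq> b \<and> v @ [a] \<in> language X \<and> v @ [b :: 'a] \<in> language X"
proof (induction n)
  case 0
  show ?case using letters ab by (intro exI[of _ "[]"]) auto
next
  case (Suc n)
  then obtain v a b where v: "length v = n" "a \<noteq> b" "v @ [a] \<in> language X" "v @ [b] \<in> language X" by blast
  have vL: "v \<in> language X" by (rule language_sublist[OF v(3)]) simp
  show ?case
  proof (rule ccontr)
    assume no: "\<not> ?case"
    have uniq: "c = d" if "e # v @ [c] \<in> language X" "e # v @ [d] \<in> language X" for c d e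
      using no that v(1) by (metis append_Cons length_Cons)
    \<comment> \<open>\<open>P\<close> describes the component of \<open>Inr a\<close>: on the right
      only \<open>a\<close>, on the left the letters adjacent to it.\<close>
    define P where "P u = (case u of Inl e \<Rightarrow> e # v @ [a] \<in> language X | Inr c \<Rightarrow> c = a)" for u :: "'a + 'a"
    have "Inr a \<in> ext_verts X v" "Inr b \<in> ext_verts X v" using v by (auto simp: ext_verts_def)
    from dendric_connected[OF den vL this] have "P (Inr b)"
    proof (induction rule: rtrancl_induct)
      case base
      then show ?case by (simp add: P_def)
    next
      case (step y z)
      then have "{y, z} \<in> ext_edges X v" by simp
      then show ?case
      proof (cases rule: ext_edges_cases)
        case (1 e c)
        then show ?thesis using step.IH uniq by (auto simp: P_def)
      next
        case (2 e c)
        then show ?thesis using step.IH by (simp add: P_def)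
      qed
    qed
    then show False using v by (simp add: P_def)
  qed
qed

section \<open>Invariant measures and cylinder masses\<close>

locale shift_measure = prob_space \<mu> for \<mu> :: "(int \<Rightarrow> 'a::finite) measure" +
  fixes X
  assumes space: "space \<mu> = X"
    and sets: "sets \<mu> = sigma_sets X {U. openin (subtopology full_shift_topology X) U}"
    and inv: "shift_invariant \<mu>"
begin

lemma coordinate_measurable [measurable]: "(\<lambda>x. x n) \<in> measurable \<mu> (count_space UNIV)"
proof -
  have "{x \<in> space \<mu>. x n = a} \<in> sets \<mu>" for a
  proof -
    have "continuous_map full_shift_topology (discrete_topology UNIV) (\<lambda>x :: int \<Rightarrow> 'a. x n)"
      unfolding full_shift_topology_def by (rule continuous_map_product_projection) simp
    then have "openin full_shift_topology {x \<in> topspace full_shift_topology. x n \<in> {a}}"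
      by (rule openin_continuous_map_preimage) simp
    moreover have "topspace (full_shift_topology :: (int \<Rightarrow> 'a) topology) = UNIV"
      by (simp add: full_shift_topology_def)
    ultimately have "openin (subtopology full_shift_topology X) ({x. x n = a} \<inter> X)"
      by (auto simp: openin_subtopology)
    moreover have "{x \<in> space \<mu>. x n = a} = {x. x n = a} \<inter> X" by (auto simp: space)
    ultimately show ?thesis unfolding sets by auto
  qed
  then show ?thesis
    by (auto simp: measurable_count_space_eq2_countable vimage_def Int_def conj_commute)
qed

lemma subword_measurable [measurable]: "(\<lambda>x. subword x i j) \<in> measurable \<mu> (count_space UNIV)"
proof -
  have "{x \<in> space \<mu>. subword x i j = w} \<in> sets \<mu>" for w
  proof -
    have "{x \<in> space \<mu>. subword x i j = w} =
        {x \<in> space \<mu>. length w = nat (j - i) \<and> (\<forall>k\<in>{..<length w}. x (i + int k) = w ! k)}"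
      by (auto simp: list_eq_iff_nth_eq subword_eq_map)
    also have "\<dots> \<in> sets \<mu>" by measurable
    finally show ?thesis .
  qed
  then show ?thesis
    by (auto simp: measurable_count_space_eq2_countable vimage_def Int_def conj_commute)
qed

lemma prob_shift:
  assumes "{x \<in> space \<mu>. P x} \<in> sets \<mu>"
  shows "\<P>(x in \<mu>. P (shift_map x)) = \<P>(x in \<mu>. P x)"
proof -
  have sm: "shift_map \<in> measurable \<mu> \<mu>" and d: "distr \<mu> \<mu> shift_map = \<mu>"
    using inv by (auto simp: shift_invariant_def)
  have "measure \<mu> {x \<in> space \<mu>. P x} = measure (distr \<mu> \<mu> shift_map) {x \<in> space \<mu>. P x}"
    by (simp add: d)
  also have "\<dots> = measure \<mu> (shift_map -` {x \<in> space \<mu>. P x} \<inter> space \<mu>)"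
    using sm assms by (rule measure_distr)
  also have "shift_map -` {x \<in> space \<mu>. P x} \<inter> space \<mu> = {x \<in> space \<mu>. P (shift_map x)}"
    using measurable_space[OF sm] by auto
  finally show ?thesis by simp
qed

lemma prob_subword_shift: "\<P>(x in \<mu>. P (subword x (i + int k) (j + int k))) = \<P>(x in \<mu>. P (subword x i j))"
proof (induction k)
  case (Suc k)
  have "\<P>(x in \<mu>. P (subword (shift_map x) (i + int k) (j + int k))) = \<P>(x in \<mu>. P (subword x (i + int k) (j + int k)))"
    by (rule prob_shift) measurable
  then show ?case using Suc by (simp add: subword_shift_map algebra_simps)
qed simp

definition cyl :: "'a list \<Rightarrow> real" where
  "cyl w = \<P>(x in \<mu>. subword x 0 (int (length w)) = w)"

lemma cyl_shift: "\<P>(x in \<mu>. subword x (int k) (int k + int (length w)) = w) = cyl w"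
  using prob_subword_shift[of "\<lambda>v. v = w" 0 k "int (length w)"] by (simp add: cyl_def add.commute)

lemma cyl_le_1: "cyl w \<le> 1"
  by (simp add: cyl_def)

lemma cyl_notin_language:
  assumes "w \<notin> language X"
  shows "cyl w = 0"
proof -
  have "{x \<in> space \<mu>. subword x 0 (int (length w)) = w} = {}"
    using assms subword_mem_language[of _ X 0 "int (length w)"] by (force simp: space)
  then show ?thesis by (simp only: cyl_def measure_empty)
qed

text \<open>Every point shows \<open>w\<close> at some position below \<open>n\<close>, so
  \<open>n\<close> shifted cylinders of equal mass cover the space.\<close>

lemma cyl_lower:
  assumes w: "w \<in> language X" "w \<noteq> []"
    and rec: "\<And>z. z \<in> language X \<Longrightarrow> n \<le> length z \<Longrightarrow> sublist w z"
  shows "1 \<le> real n * cyl w"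
proof -
  let ?B = "\<lambda>k. {x \<in> space \<mu>. subword x (int k) (int k + int (length w)) = w}"
  have "space \<mu> \<subseteq> (\<Union>k<n. ?B k)"
  proof
    fix x assume x: "x \<in> space \<mu>"
    have "sublist w (subword x 0 (int n))"
      using x by (intro rec subword_mem_language) (auto simp: space)
    then obtain p s where ps: "subword x 0 (int n) = p @ w @ s" by (auto simp: sublist_def)
    have "length p < n" using arg_cong[OF ps, of length] w(2) by (cases w) auto
    then show "x \<in> (\<Union>k<n. ?B k)" using subword_append_eq[OF ps] x by auto
  qed
  then have "prob (space \<mu>) \<le> prob (\<Union>k<n. ?B k)" by (rule finite_measure_mono) measurable
  then have "1 \<le> prob (\<Union>k<n. ?B k)" by (simp only: prob_space)
  also have "\<dots> \<le> (\<Sum>k<n. prob (?B k))"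
    by (rule finite_measure_subadditive_finite) auto
  also have "\<dots> = real n * cyl w" by (simp add: cyl_shift)
  finally show ?thesis .
qed

text \<open>The first \<open>n\<close> shifted cylinders are disjoint and have equal mass.\<close>

lemma cyl_upper:
  assumes disj: "\<And>x i j. x \<in> X \<Longrightarrow> i < j \<Longrightarrow> j < n \<Longrightarrow> subword x (int i) (int i + int (length w)) = w \<Longrightarrow>
      subword x (int j) (int j + int (length w)) = w \<Longrightarrow> False"
  shows "real n * cyl w \<le> 1"
proof -
  let ?B = "\<lambda>k. {x \<in> space \<mu>. subword x (int k) (int k + int (length w)) = w}"
  have "disjoint_family_on ?B {..<n}"
    unfolding disjoint_family_on_def using disj by (auto simp: space) (metis nat_neq_iff)
  then have "(\<Sum>k<n. prob (?B k)) = prob (\<Union>k<n. ?B k)"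
    by (intro finite_measure_finite_Union[symmetric]) auto
  also have "\<dots> \<le> 1" by (rule prob_le_1)
  finally show ?thesis by (simp add: cyl_shift)
qed


text \<open>Two occurrences of \<open>w\<close> at a small distance \<open>r\<close> would give
  \<open>w\<close> the period \<open>r\<close>, so that a factor of length \<open>r\<close> has only
  one continuation inside \<open>w\<close>. By recurrence, however, \<open>w\<close> contains both
  continuations of a right special word of length \<open>r\<close>.\<close>

lemma cyl_upper_dendric:
  assumes den: "dendric X" and letters: "\<And>a. [a] \<in> language X" and ab: "a0 \<noteq> (b0 :: 'a)"
    and C: "1 \<le> C"
    and rec: "\<And>w z. w \<in> language X \<Longrightarrow> z \<in> language X \<Longrightarrow> w \<noteq> [] \<Longrightarrow> C * length w \<le> length z \<Longrightarrow> sublist w z"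
    and w: "w \<in> language X"
  shows "real (length w) * cyl w \<le> 2 * real C"
proof -
  \<comment> \<open>Distances below this \<open>n\<close> satisfy
    \<open>2 * C * r \<le> length w\<close>, while still
    \<open>length w \<le> 2 * C * n\<close>.\<close>
  define n where "n = length w div (2 * C) + 1"
  have "real n * cyl w \<le> 1"
  proof (rule cyl_upper)
    fix x i j assume x: "x \<in> X" and ij: "i < j" "j < n"
      and wi: "subword x (int i) (int i + int (length w)) = w"
      and wj: "subword x (int j) (int j + int (length w)) = w"
    define r where "r = j - i"
    have r: "0 < r" "j = i + r" using ij by (auto simp: r_def)
    have "r \<le> length w div (2 * C)" using ij by (simp add: r_def n_def)
    then have "r * (2 * C) \<le> length w" using C by (simp add: less_eq_div_iff_mult_less_eq)
    \<comment> \<open>Since \<open>r \<ge> 1\<close>, the factor 2 makes room for the additional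
      letter after the right special word.\<close>
    moreover have "C * (r + 1) \<le> r * (2 * C)" using r by (simp add: algebra_simps)
    ultimately have len: "C * (r + 1) \<le> length w" by linarith
    have per: "w ! (k + r) = w ! k" if "k + r < length w" for k
    proof -
      have "w ! (k + r) = x (int i + int (k + r))" "w ! k = x (int j + int k)"
        by (subst wi[symmetric], use that in \<open>simp add: subword_eq_map\<close>)
           (subst wj[symmetric], use that in \<open>simp add: subword_eq_map\<close>)
      then show ?thesis using r by (simp add: algebra_simps)
    qed
    obtain v a b where v: "length v = r" "a \<noteq> b" "v @ [a] \<in> language X" "v @ [b] \<in> language X"
      using dendric_right_special[OF den letters ab, of r] by blast
    have next_letter: "c = hd v" if c: "v @ [c] \<in> language X" for c
    proof -
      have "sublist (v @ [c]) w" using c w len v by (intro rec) auto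
      then obtain p s where ps: "w = p @ (v @ [c]) @ s" by (auto simp: sublist_def)
      have "w ! (length p + r) = c" using v by (simp add: ps nth_append)
      moreover have "w ! length p = hd v" using v r by (cases v) (auto simp: ps nth_append)
      moreover have "length p + r < length w" using v by (simp add: ps)
      ultimately show ?thesis using per[of "length p"] by simp
    qed
    show False using next_letter[OF v(3)] next_letter[OF v(4)] v(2) by simp
  qed
  moreover have "length w \<le> 2 * C * n"
    using C dividend_less_times_div[of "2 * C" "length w"] by (simp add: n_def)
  then have "real (length w) \<le> 2 * real C * real n" by (metis of_nat_le_iff of_nat_mult of_nat_numeral)
  then have "real (length w) * cyl w \<le> 2 * real C * real n * cyl w"
    by (intro mult_right_mono) (auto simp: cyl_def)
  ultimately show ?thesis
    using mult_left_mono[of "real n * cyl w" 1 "2 * real C"] by (simp add: mult.assoc)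
qed

text \<open>The mass of \<open>v\<close> is at least \<open>1 / (C * length v)\<close> and that of
  \<open>w\<close> at most \<open>2 * C / length w\<close>. The empty \<open>v\<close> has mass 1;
  over a single letter, where no word is right special, all cylinders have mass 1.\<close>

lemma cyl_ratio:
  assumes den: "dendric X" and letters: "\<And>a. [a] \<in> language X" and C: "1 \<le> C"
    and rec: "\<And>w z. w \<in> language X \<Longrightarrow> z \<in> language X \<Longrightarrow> w \<noteq> [] \<Longrightarrow> C * length w \<le> length z \<Longrightarrow> sublist w z"
    and w: "w \<in> language X" "w \<noteq> []" and v: "v \<in> language X" "length v \<le> D * length w" and D: "1 \<le> D"
  shows "1 / (2 * real C * real C * real D) * cyl w \<le> cyl v"
proof (cases "\<exists>a b :: 'a. a \<noteq> b")
  case True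
  then obtain a0 b0 :: 'a where ab: "a0 \<noteq> b0" by blast
  have CD: "1 \<le> 2 * real C * real C * real D" using C D by (simp add: mult_ge1_I flip: of_nat_mult)
  show ?thesis
  proof (cases "v = []")
    case True
    have "cyl v = 1" using prob_space by (simp add: True cyl_def subword_def)
    then show ?thesis using CD cyl_le_1[of w] by (simp add: divide_le_eq)
  next
    case False
    have "1 \<le> real (C * length v) * cyl v" using v False by (intro cyl_lower rec) auto
    also have "\<dots> \<le> real (C * (D * length w)) * cyl v"
      using v(2) by (intro mult_right_mono of_nat_mono mult_le_mono2) (auto simp: cyl_def)
    finally have lo: "1 \<le> real C * real D * real (length w) * cyl v" by simp
    have "real (length w) * cyl w \<le> 2 * real C * 1"
      using cyl_upper_dendric[OF den letters ab C rec w(1)] by simp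
    also have "\<dots> \<le> 2 * real C * (real C * real D * real (length w) * cyl v)"
      using lo by (intro mult_left_mono) auto
    also have "\<dots> = real (length w) * (2 * real C * real C * real D * cyl v)" by simp
    finally have "cyl w \<le> 2 * real C * real C * real D * cyl v" using w(2) by simp
    then have "cyl w \<le> cyl v * (2 * real C * real C * real D)" by (simp only: mult.commute)
    then have "cyl w / (2 * real C * real C * real D) \<le> cyl v"
      by (subst pos_divide_le_eq) (use CD in linarith)+
    then show ?thesis by simp
  qed
next
  case False
  have all: "cyl u = 1" for u
  proof -
    have "subword x 0 (int (length u)) = u" for x :: "int \<Rightarrow> 'a"
      using False by (intro nth_equalityI) auto
    then show ?thesis using prob_space by (simp add: cyl_def)
  qed
  have "1 \<le> 2 * real C * real C * real D" using C D by (simp add: mult_ge1_I flip: of_nat_mult)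
  then show ?thesis by (simp add: all)
qed

end

section \<open>Densities of group languages\<close>

text \<open>Compactness yields only convergent subsequences of the averages; this reduces
  convergence to identifying their limits.\<close>

lemma LIMSEQ_by_subsequences:
  fixes f :: "nat \<Rightarrow> real"
  assumes "\<And>r :: nat \<Rightarrow> nat. strict_mono r \<Longrightarrow> \<exists>k. strict_mono (k :: nat \<Rightarrow> nat) \<and> (\<lambda>n. f (r (k n))) \<longlonglongrightarrow> l"
  shows "f \<longlonglongrightarrow> l"
proof (rule ccontr)
  assume "\<not> f \<longlonglongrightarrow> l"
  then obtain e where e: "0 < e" "\<And>N. \<exists>n\<ge>N. e \<le> dist (f n) l"
    unfolding lim_sequentially by (meson not_less)
  have "infinite {n. e \<le> dist (f n) l}"
    unfolding infinite_nat_iff_unbounded_le using e(2) by auto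
  then obtain r :: "nat \<Rightarrow> nat" where r: "strict_mono r" "\<And>n. r n \<in> {n. e \<le> dist (f n) l}"
    using infinite_enumerate by blast
  obtain k :: "nat \<Rightarrow> nat" where "(\<lambda>n. f (r (k n))) \<longlonglongrightarrow> l" using assms[OF r(1)] by blast
  then have "eventually (\<lambda>n. dist (f (r (k n))) l < e) sequentially" using e(1) by (rule tendstoD)
  then obtain n where "dist (f (r (k n))) l < e" by (auto simp: eventually_sequentially)
  then show False using r(2)[of "k n"] by simp
qed

locale group_cocycle = shift_measure \<mu> X + group G
  for \<mu> :: "(int \<Rightarrow> 'a::finite) measure" and X and G :: "('g, 'b) monoid_scheme" (structure) +
  fixes \<phi> :: "'a list \<Rightarrow> 'g"
  assumes fin: "finite (carrier G)" and hom: "\<phi> \<in> monoid_hom free_monoid G"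
begin

lemmas hom_append = monoid_hom_free_append[OF hom]
lemmas hom_closed [simp] = monoid_hom_free_closed[OF hom]

text \<open>The law at time \<open>i\<close> of the skew product started at the identity of
  \<open>G\<close>, evaluated on \<open>g\<close> and the cylinder of \<open>w\<close>.\<close>

definition joint :: "nat \<Rightarrow> 'g \<Rightarrow> 'a list \<Rightarrow> real" where
  "joint i g w = \<P>(x in \<mu>. \<phi> (subword x 0 (int i)) = g \<and> subword x (int i) (int i + int (length w)) = w)"

lemma joint_right: "joint i g w = (\<Sum>b\<in>UNIV. joint i g (w @ [b]))"
  unfolding joint_def
proof (rule prob_sum)
  show "AE x in \<mu>. (\<forall>b\<in>UNIV. \<phi> (subword x 0 (int i)) = g \<and>
            subword x (int i) (int i + int (length (w @ [b]))) = w @ [b] \<longrightarrow>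
          \<phi> (subword x 0 (int i)) = g \<and> subword x (int i) (int i + int (length w)) = w) \<and>
      (\<phi> (subword x 0 (int i)) = g \<and> subword x (int i) (int i + int (length w)) = w \<longrightarrow>
        (\<exists>!b. b \<in> UNIV \<and> \<phi> (subword x 0 (int i)) = g \<and>
           subword x (int i) (int i + int (length (w @ [b]))) = w @ [b]))"
    by (rule AE_I2) (simp add: subword_snoc del: of_nat_Suc)
qed (simp, measurable)

text \<open>Advancing time by one moves the letter at position \<open>i\<close> from the cylinder
  word into the group coordinate.\<close>

lemma joint_left:
  assumes g: "g \<in> carrier G"
  shows "joint (Suc i) g w = (\<Sum>a\<in>UNIV. joint i (g \<otimes> inv (\<phi> [a])) (a # w))"
  unfolding joint_def
proof (rule prob_sum)
  have eq: "\<phi> (u @ [a]) = g \<longleftrightarrow> \<phi> u = g \<otimes> inv (\<phi> [a])" for u a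
    using g by (metis hom_append hom_closed inv_solve_right)
  have s0: "subword x 0 (int (Suc i)) = subword x 0 (int i) @ [x (int i)]" for x :: "int \<Rightarrow> 'a"
    using subword_snoc[of x 0 i] by simp
  have s1: "subword x (int i) (int i + int (length (a # w))) =
      x (int i) # subword x (int (Suc i)) (int (Suc i) + int (length w))" for x :: "int \<Rightarrow> 'a" and a
    using subword_Cons[of x "int i" "length w"] by (simp add: algebra_simps)
  show "AE x in \<mu>. (\<forall>a\<in>UNIV. \<phi> (subword x 0 (int i)) = g \<otimes> inv (\<phi> [a]) \<and>
            subword x (int i) (int i + int (length (a # w))) = a # w \<longrightarrow>
          \<phi> (subword x 0 (int (Suc i))) = g \<and> subword x (int (Suc i)) (int (Suc i) + int (length w)) = w) \<and>
      (\<phi> (subword x 0 (int (Suc i))) = g \<and> subword x (int (Suc i)) (int (Suc i) + int (length w)) = w \<longrightarrow>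
        (\<exists>!a. a \<in> UNIV \<and> \<phi> (subword x 0 (int i)) = g \<otimes> inv (\<phi> [a]) \<and>
           subword x (int i) (int i + int (length (a # w))) = a # w))"
    unfolding s0 s1 eq by (rule AE_I2) auto
qed (simp, measurable)

lemma joint_sum: "(\<Sum>g\<in>carrier G. joint i g w) = cyl w"
proof -
  have "\<P>(x in \<mu>. subword x (int i) (int i + int (length w)) = w) = (\<Sum>g\<in>carrier G. joint i g w)"
    unfolding joint_def by (rule prob_sum) (use fin in auto)
  then show ?thesis by (simp add: cyl_shift)
qed

text \<open>Krylov-Bogolyubov averages: their limit points are invariant weights.\<close>

definition average :: "nat \<Rightarrow> 'g \<Rightarrow> 'a list \<Rightarrow> real" where
  "average n g w = 1 / real n * (\<Sum>i<n. joint i g w)"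

lemma joint_bounds: "0 \<le> joint i g w" "joint i g w \<le> 1"
  by (auto simp: joint_def)

lemma average_bounds: "0 \<le> average n g w" "average n g w \<le> 1"
proof -
  show "0 \<le> average n g w" unfolding average_def using joint_bounds by (intro mult_nonneg_nonneg sum_nonneg) auto
  have "(\<Sum>i<n. joint i g w) \<le> (\<Sum>i<n. 1)" using joint_bounds by (intro sum_mono) auto
  then show "average n g w \<le> 1" by (cases "n = 0") (auto simp: average_def divide_simps)
qed

lemma average_right: "average n g w = (\<Sum>b\<in>UNIV. average n g (w @ [b]))"
proof -
  have "(\<Sum>i<n. joint i g w) = (\<Sum>b\<in>UNIV. \<Sum>i<n. joint i g (w @ [b]))"
    by (subst sum.swap) (intro sum.cong refl joint_right)
  then show ?thesis by (simp add: average_def sum_divide_distrib)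
qed

lemma average_sum: "n \<noteq> 0 \<Longrightarrow> (\<Sum>g\<in>carrier G. average n g w) = cyl w"
  unfolding average_def sum_distrib_left[symmetric]
  by (subst sum.swap) (simp add: joint_sum)

text \<open>By \<open>joint_left\<close> the difference telescopes, leaving two boundary terms that
  vanish in the limit.\<close>

lemma average_left:
  assumes g: "g \<in> carrier G"
  shows "average n g w - (\<Sum>a\<in>UNIV. average n (g \<otimes> inv (\<phi> [a])) (a # w)) = (joint 0 g w - joint n g w) / real n"
proof -
  have "(\<Sum>a\<in>UNIV. \<Sum>i<n. joint i (g \<otimes> inv (\<phi> [a])) (a # w)) = (\<Sum>i<n. joint (Suc i) g w)"
    by (subst sum.swap) (intro sum.cong refl joint_left[OF g, symmetric])
  then have "average n g w - (\<Sum>a\<in>UNIV. average n (g \<otimes> inv (\<phi> [a])) (a # w)) =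
      1 / real n * (\<Sum>i<n. joint i g w) - 1 / real n * (\<Sum>i<n. joint (Suc i) g w)"
    unfolding average_def sum_distrib_left[symmetric] by simp
  also have "\<dots> = (\<Sum>i<n. joint i g w - joint (Suc i) g w) / real n"
    by (simp add: sum_subtractf diff_divide_distrib)
  also have "\<dots> = (joint 0 g w - joint n g w) / real n" by (simp add: sum_lessThan_telescope'[of "\<lambda>i. joint i g w"])
  finally show ?thesis .
qed

lemma average_left_limit:
  assumes g: "g \<in> carrier G" and r: "strict_mono (r :: nat \<Rightarrow> nat)"
  shows "(\<lambda>n. average (r n) g w - (\<Sum>a\<in>UNIV. average (r n) (g \<otimes> inv (\<phi> [a])) (a # w))) \<longlonglongrightarrow> 0"
proof -
  have "(\<lambda>n. (joint 0 g w - joint n g w) * inverse (real n)) \<longlonglongrightarrow> 0"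
  proof (rule tendsto_rabs_zero_cancel, rule tendsto_sandwich[OF _ _ tendsto_const lim_inverse_n])
    have "\<bar>joint 0 g w - joint n g w\<bar> \<le> 1" for n
      using joint_bounds[of 0 g w] joint_bounds[of n g w] by linarith
    then show "eventually (\<lambda>n. \<bar>(joint 0 g w - joint n g w) * inverse (real n)\<bar> \<le> inverse (real n)) sequentially"
      by (intro always_eventually allI) (simp add: abs_mult mult_left_le_one_le)
  qed simp
  then have "(\<lambda>n. average n g w - (\<Sum>a\<in>UNIV. average n (g \<otimes> inv (\<phi> [a])) (a # w))) \<longlonglongrightarrow> 0"
    unfolding average_left[OF g] by (simp add: divide_inverse)
  from LIMSEQ_subseq_LIMSEQ[OF this r] show ?thesis by (simp add: comp_def)
qed

text \<open>Any limit point of the averages satisfies \<open>skew_weights\<close>, so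
  \<open>q_Nil_uniform\<close> forces the same value along every convergent subsequence.\<close>

theorem average_Nil_limit:
  assumes den: "dendric X" and letters: "\<And>a. [a] \<in> language X" and C: "1 \<le> C"
    and rec: "\<And>w z. w \<in> language X \<Longrightarrow> z \<in> language X \<Longrightarrow> w \<noteq> [] \<Longrightarrow> C * length w \<le> length z \<Longrightarrow> sublist w z"
    and onto: "\<phi> ` UNIV = carrier G"
    and g: "g \<in> carrier G"
  shows "(\<lambda>n. average n g []) \<longlonglongrightarrow> 1 / real (card (carrier G))"
proof (rule LIMSEQ_by_subsequences)
  fix r :: "nat \<Rightarrow> nat" assume r: "strict_mono r"
  have cnt: "countable (carrier G \<times> (UNIV :: 'a list set))" using fin by (auto intro: countable_finite)
  have "norm (average (r n) (fst p) (snd p)) \<le> 1" for n p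
    using average_bounds[of "r n" "fst p" "snd p"] by simp
  \<comment> \<open>There are countably many pairs of a group element and a word, so a diagonal
    choice gives convergence for all of them at once.\<close>
  then obtain k where k: "strict_mono (k :: nat \<Rightarrow> nat)"
    and lim: "\<And>p. p \<in> carrier G \<times> UNIV \<Longrightarrow> \<exists>l. (\<lambda>n. average (r (k n)) (fst p) (snd p)) \<longlonglongrightarrow> l"
    by (rule function_convergent_subsequence[OF cnt, of "\<lambda>n p. average (r n) (fst p) (snd p)"]) (use that in blast)
  define R where "R n = r (k n)" for n
  have R: "strict_mono R" using strict_mono_o[OF r k] by (simp add: R_def[abs_def] comp_def)
  define q where "q g w = lim (\<lambda>n. average (R n) g w)" for g w
  have q: "(\<lambda>n. average (R n) g w) \<longlonglongrightarrow> q g w" if "g \<in> carrier G" for g w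
    using lim[of "(g, w)"] that unfolding q_def R_def by (simp add: convergent_def flip: convergent_LIMSEQ_iff)
  have "skew_weights G \<phi> cyl q"
  proof
    show "finite (carrier G)" by (rule fin)
    show "\<phi> \<in> monoid_hom free_monoid G" by (rule hom)
    show "cyl [] = 1" using prob_space by (simp add: cyl_def subword_def)
  next
    fix g w assume g: "g \<in> carrier G"
    show "0 \<le> q g w" using q[OF g] by (rule LIMSEQ_le_const) (use average_bounds in auto)
    have "(\<lambda>n. average (R n) g w) \<longlonglongrightarrow> (\<Sum>b\<in>UNIV. q g (w @ [b]))"
      by (subst average_right) (intro tendsto_sum q g)
    then show "q g w = (\<Sum>b\<in>UNIV. q g (w @ [b]))" using q[OF g] LIMSEQ_unique by blast
    have "(\<lambda>n. average (R n) g w - (\<Sum>a\<in>UNIV. average (R n) (g \<otimes> inv (\<phi> [a])) (a # w)))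
        \<longlonglongrightarrow> q g w - (\<Sum>a\<in>UNIV. q (g \<otimes> inv (\<phi> [a])) (a # w))"
      using g by (intro tendsto_diff tendsto_sum q) auto
    from LIMSEQ_unique[OF this average_left_limit[OF g R]]
    show "q g w = (\<Sum>a\<in>UNIV. q (g \<otimes> inv (\<phi> [a])) (a # w))" by simp
  next
    fix w
    have "(\<lambda>n. \<Sum>g\<in>carrier G. average (R n) g w) \<longlonglongrightarrow> (\<Sum>g\<in>carrier G. q g w)"
      by (intro tendsto_sum q)
    moreover have "(\<lambda>n. \<Sum>g\<in>carrier G. average (R n) g w) \<longlonglongrightarrow> cyl w"
    proof (rule tendsto_eventually, rule eventually_sequentiallyI)
      fix n :: nat assume "1 \<le> n"
      then have "R n \<noteq> 0" using seq_suble[OF R, of n] by linarith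
      then show "(\<Sum>g\<in>carrier G. average (R n) g w) = cyl w" by (rule average_sum)
    qed
    ultimately show "(\<Sum>g\<in>carrier G. q g w) = cyl w" by (rule LIMSEQ_unique)
  qed
  then interpret sw: skew_weights G \<phi> cyl q .
  \<comment> \<open>With \<open>n = D * length w - 1\<close> one has
    \<open>n \<ge> C * length w\<close> for nonempty \<open>w\<close>, so recurrence applies at
    length \<open>n\<close>, and the return bound \<open>Suc n\<close> is exactly
    \<open>D * length w\<close>.\<close>
  define D where "D = C + 1"
  \<comment> \<open>Recurrence gives every factor positive mass, so the words of positive mass are
    exactly the language, as needed for the returns.\<close>
  have pos: "0 < cyl w \<longleftrightarrow> w \<in> language X" for w
  proof
    show "w \<in> language X" if "0 < cyl w" using that cyl_notin_language[of w] by auto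
    assume w: "w \<in> language X"
    show "0 < cyl w"
    proof (cases "w = []")
      case False
      then have "1 \<le> real (C * length w) * cyl w" using w by (intro cyl_lower rec) auto
      then show ?thesis by (metis linorder_not_less mult_nonneg_nonpos of_nat_0_le_iff order_trans zero_less_one)
    qed (use sw.m_Nil in simp)
  qed
  have "q g [] = 1 / real (card (carrier G))"
  proof (rule sw.q_Nil_uniform)
    show "0 < 1 / (2 * real C * real C * real D)" "1 \<le> D" using C by (auto simp: D_def)
    show "1 / (2 * real C * real C * real D) * cyl w \<le> cyl v"
      if "w \<noteq> []" "0 < cyl w" "0 < cyl v" "length v \<le> D * length w" for w v
      using that by (intro cyl_ratio[OF den letters C rec]) (auto simp: pos D_def)
    show "generate G (\<phi> ` close_returns {v. 0 < cyl v} w (D * length w)) = carrier G"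
      if w: "w \<noteq> []" "0 < cyl w" for w
    proof -
      have S: "Suc (D * length w - 1) = D * length w" using w by (simp add: D_def)
      have len: "C * length w \<le> D * length w - 1" using w(1) by (cases w) (auto simp: D_def)
      have "length w \<le> C * length w" using C by simp
      then have "length w \<le> D * length w - 1" using len by (rule le_trans)
      then have "generate G (\<phi> ` close_returns (language X) w (Suc (D * length w - 1))) = carrier G"
        using w len by (intro dendric_returns_generate[OF den letters is_group hom onto] rec) (auto simp: pos)
      then show ?thesis by (simp only: S pos Collect_mem_eq)
    qed
    show "g \<in> carrier G" by (rule g)
  qed
  then show "\<exists>k. strict_mono (k :: nat \<Rightarrow> nat) \<and> (\<lambda>n. average (r (k n)) g []) \<longlonglongrightarrow> 1 / real (card (carrier G))"
    using q[OF g, of "[]"] k by (auto simp: R_def)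
qed

lemma density_average:
  assumes "K \<subseteq> carrier G"
  shows "1 / real n * (\<Sum>i<n. measure \<mu> {x \<in> space \<mu>. subword x 0 (int i) \<in> \<phi> -` K}) = (\<Sum>g\<in>K. average n g [])"
proof -
  have [simp]: "subword x j j = []" for x :: "int \<Rightarrow> 'a" and j by (simp add: subword_def)
  have fK: "finite K" using assms fin finite_subset by blast
  have "measure \<mu> {x \<in> space \<mu>. subword x 0 (int i) \<in> \<phi> -` K} = (\<Sum>g\<in>K. joint i g [])" for i
    unfolding joint_def by (rule prob_sum) (use fK in auto)
  then show ?thesis
    unfolding average_def sum_distrib_left[symmetric] by (simp, subst sum.swap) simp
qed

end

theorem corollary8p12:
  fixes X :: "(int \<Rightarrow> 'a::finite) set"
    and \<sigma> :: "'a list \<Rightarrow> 'a list"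
    and \<mu> :: "(int \<Rightarrow> 'a) measure"
    and G :: "('g, 'm) monoid_scheme"
    and \<phi> :: "'a list \<Rightarrow> 'g"
    and K :: "'g set"
  assumes "shift_space X"
    and "dendric X"
    and "primitive_substitution \<sigma>"
    and "X = substitution_shift \<sigma>"
    and "ergodic_measure_on X \<mu>"
    and "group G"
    and "finite (carrier G)"
    and "\<phi> \<in> monoid_hom free_monoid G"
    and "\<phi> ` carrier free_monoid = carrier G"
    and "K \<subseteq> carrier G"
  shows "has_density \<mu> (\<phi> -` K) (real (card K) / real (card (carrier G)))"
proof -
  interpret prob_space \<mu>
    using assms(5) by (simp add: ergodic_measure_on_def borel_probability_on_def)
  interpret group G by (rule assms(6))
  interpret group_cocycle \<mu> X G \<phi>
    using assms by unfold_locales (simp_all add: ergodic_measure_on_def borel_probability_on_def)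
  have letters: "[a] \<in> language X" for a
  proof -
    obtain x n where "x \<in> X" "x n = a" using assms(1) unfolding shift_space_def by meson
    then show ?thesis using subword_mem_language[of x X n "n + 1"] by (simp add: subword_single)
  qed
  have sub: "language X \<subseteq> substitution_factors \<sigma>"
    unfolding assms(4) by (rule language_substitution_shift)
  obtain x where x: "x \<in> X" using assms(1) by (auto simp: shift_space_def)
  \<comment> \<open>A point of \<open>X\<close> supplies factors of every length, the unboundedness
    required for linear recurrence.\<close>
  have "\<exists>w\<in>substitution_factors \<sigma>. N \<le> length w" for N
    using subword_mem_language[OF x, of 0 "int N"] sub by (intro bexI[of _ "subword x 0 (int N)"]) auto
  from primitive_linearly_recurrent[OF assms(3) this] obtain C where "1 \<le> C"
    and "\<And>w z. w \<in> language X \<Longrightarrow> z \<in> language X \<Longrightarrow> w \<noteq> [] \<Longrightarrow> C * length w \<le> length z \<Longrightarrow> sublist w z"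
    using sub by blast
  moreover have "\<phi> ` UNIV = carrier G" using assms(9) by (simp add: free_monoid_def)
  ultimately have "(\<lambda>n. average n g []) \<longlonglongrightarrow> 1 / real (card (carrier G))" if "g \<in> K" for g
    using assms(2,10) letters that by (intro average_Nil_limit) auto
  then have "(\<lambda>n. \<Sum>g\<in>K. average n g []) \<longlonglongrightarrow> (\<Sum>g\<in>K. 1 / real (card (carrier G)))"
    by (intro tendsto_sum)
  then show ?thesis unfolding has_density_def density_average[OF assms(10)] by simp
qed

end
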